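(* Let $n=\max\{n_a,n_b\}$. Algorithm A (described in the context; input dimension $2$) has time complexity $O(n(\log n)^2)$, and Algorithm B (described in the context; input dimension $d\ge3$, $d$ fixed) has time complexity $O(n(\log n)^d)$. Moreover, the two algorithms are correct: on input $\{\boldsymbol a_i\}_{i=1}^{n_a},\{\boldsymbol b_i\}_{i=1}^{n_b}\subset\mathbb{R}^d$ (with $d=2$ for Algorithm A), the values $c_1,\dots,c_{n_b}$ they output satisfy $c_i=\sum_{i'=1}^{n_a}\mathbb{1}\{\boldsymbol a_{i'}\le\boldsymbol b_i\}$ for every $i\in\{1,\dots,n_b\}$.
   Context: For vectors, $\boldsymbol a\le\boldsymbol b$ is meant entrywise; $\boldsymbol a_{i,k}$ is the $k$-th coordinate of $\boldsymbol a_i$, and $\boldsymbol a_{i,\{2,\dots,d\}}$ is the subvector of coordinates $2,\dots,d$. Time is counted in elementary operations (comparisons and arithmetic operations at unit cost). Both algorithms take two finite families of vectors $\{\boldsymbol a_i\}_{i=1}^{n_a},\{\boldsymbol b_i\}_{i=1}^{n_b}$ in $\mathbb{R}^d$ and start with the following two steps. (1) Sort $\{\boldsymbol a_i\}$ by first coordinate, so that $\boldsymbol a_{1,1}\le\dots\le\boldsymbol a_{n_a,1}$. (2) For each $i\in\{1,\dots,n_b\}$, let $k_i$ be the largest $i'$ with $\boldsymbol a_{i',1}\le\boldsymbol b_{i,1}$, and initialise $c_i=1$ if $\boldsymbol a_{k_i}\le\boldsymbol b_i$ and $c_i=0$ otherwise; if $\boldsymbol b_{i,1}$ is smaller than all $\boldsymbol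 a_{i',1}$, set $k_i=0$ and $c_i=0$. Algorithm A ($d=2$; the paper's Algorithm 1). After (1)–(2), for $j=1,\dots,\lceil\log_2 n_a\rceil$: set $J'_j=\lceil n_a/2^{j-1}\rceil$; for $1\le j'\le J'_j$ form the sorted sequence $\boldsymbol e^j_{j'}$ of the second coordinates of $\boldsymbol a_{2^{j-1}(j'-1)+1},\dots,\boldsymbol a_{\min\{2^{j-1}j',n_a\}}$ (for $j>1$ these can be obtained by merging the sorted sequences of iteration $j-1$, as in merge sort); then for each $i=1,\dots,n_b$: if $k_i\le1$, skip; otherwise, if there is an even integer $\ell$ with $2^{j-1}(\ell-1)<k_i\le2^{j-1}\ell$, add to $c_i$ the quantity $\sum_{x\in\boldsymbol e^j_{\ell-1}}\mathbb{1}\{x\le\boldsymbol b_{i,2}\}$ (computed as the rank of $\boldsymbol b_{i,2}$ in the sorted sequence $\boldsymbol e^j_{\ell-1}$); otherwise leave $c_i$ unchanged. Output $c_1,\dots,c_{n_b}$. Algorithm B ($d\ge3$; the paper's Algorithm 2). After (1)–(2), for $j=1,\dots,\lceil\log_2 n_a\rceil$: set $J'_j=\lceil n_a/2^{j-1}\rceil$; for $1\le j'\le J'_j$ let $\mathcal A^j_{j'}$ be the family of $(d-1)$-dimensional vectors $\boldsymbol a_{k,\{2,\dots,d\}}$ for $2^{j-1}(j'-1)+1\le k\le\min\{2^{j-1}j',n_a\}$, and associate with it initially empty sets $\mathcal B^j_{j'}$ and $\mathcal C^j_{j'}$; for each $i=1,\dots,n_b$: if $k_i\le1$, skip; otherwise,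 if there is an even integer $\ell$ with $2^{j-1}(\ell-1)<k_i\le2^{j-1}\ell$, add $\boldsymbol b_{i,\{2,\dots,d\}}$ to $\mathcal B^j_{\ell-1}$ and $i$ to $\mathcal C^j_{\ell-1}$; then for each pair $(\mathcal A^j_{j'},\mathcal B^j_{j'})$ apply, in dimension $d-1$, Algorithm A if $d=3$ and Algorithm B (recursively) if $d\ge4$, obtaining ranks $\{c'_i:i\in\mathcal C^j_{j'}\}$, and increase $c_i$ by $c'_i$ for each $i\in\mathcal C^j_{j'}$. Output $c_1,\dots,c_{n_b}$. *)

theory Defs
  imports Complex_Main "HOL-Library.Landau_Symbols" "HOL-Library.Monad_Syntax"
begin

text \<open>
  Cost model: a computation is its result together with the number of elementary operations
  performed.  Every comparison, arithmetic operation and array access costs one unit, and every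
  loop iteration or recursive call is charged at least one unit.  Only branching on a computed
  value, tupling, and consing a computed value onto a list (always next to a charged operation)
  are free.
\<close>

datatype 'a timed = Timed (val: 'a) (time: nat)

definition return :: "'a \<Rightarrow> 'a timed" where
  "return x = Timed x 0"

definition bind_timed :: "'a timed \<Rightarrow> ('a \<Rightarrow> 'b timed) \<Rightarrow> 'b timed" where
  "bind_timed m f = Timed (val (f (val m))) (time m + time (f (val m)))"

adhoc_overloading Monad_Syntax.bind \<rightleftharpoons> bind_timed

lemma bind_timed_cong [fundef_cong]:
  assumes "m = m'" "\<And>x. x = val m' \<Longrightarrow> f x = f' x"
  shows "bind_timed m f = bind_timed m' f'"
  using assms by (simp add: bind_timed_def)

definition tick :: "unit timed" where
  "tick = Timed () 1"

definition leq :: "'a::linorder \<Rightarrow> 'a \<Rightarrow> bool timed" where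
  "leq x y = Timed (x \<le> y) 1"

definition eq :: "nat \<Rightarrow> nat \<Rightarrow> bool timed" where
  "eq m n = Timed (m = n) 1"

definition add :: "nat \<Rightarrow> nat \<Rightarrow> nat timed" where
  "add m n = Timed (m + n) 1"

definition sub :: "nat \<Rightarrow> nat \<Rightarrow> nat timed" where
  "sub m n = Timed (m - n) 1"

definition mult :: "nat \<Rightarrow> nat \<Rightarrow> nat timed" where
  "mult m n = Timed (m * n) 1"

definition quot :: "nat \<Rightarrow> nat \<Rightarrow> nat timed" where
  "quot m n = Timed (m div n) 1"

definition rem :: "nat \<Rightarrow> nat \<Rightarrow> nat timed" where
  "rem m n = Timed (m mod n) 1"

text \<open>
  Linked lists are accessed cell by cell only.  Random access needs an array, and conversion
  between the two is charged linearly.  Arrays are indexed from 1.  Charging one unit for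
  \<open>aset\<close> models an update in place; this is legitimate because the algorithms below never use
  the old array again.
\<close>

datatype 'a array = Array (elems: "'a list")

definition array_of :: "'a list \<Rightarrow> 'a array timed" where
  "array_of xs = Timed (Array xs) (length xs + 1)"

definition list_of :: "'a array \<Rightarrow> 'a list timed" where
  "list_of M = Timed (elems M) (length (elems M) + 1)"

definition new_array :: "nat \<Rightarrow> 'a \<Rightarrow> 'a array timed" where
  "new_array n x = Timed (Array (replicate n x)) (n + 1)"

definition asize :: "'a array \<Rightarrow> nat timed" where
  "asize M = Timed (length (elems M)) 1"

definition aget :: "'a array \<Rightarrow> nat \<Rightarrow> 'a timed" where
  "aget M i = Timed (elems M ! (i - 1)) 1"

definition aset :: "'a array \<Rightarrow> nat \<Rightarrow> 'a \<Rightarrow> 'a array timed" where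
  "aset M i x = Timed (Array ((elems M)[i - 1 := x])) 1"

definition head :: "'a list \<Rightarrow> 'a timed" where
  "head xs = Timed (hd xs) 1"

definition tail :: "'a list \<Rightarrow> 'a list timed" where
  "tail xs = Timed (tl xs) 1"

lemmas timed_primitive_defs =
  return_def bind_timed_def tick_def leq_def eq_def add_def sub_def mult_def quot_def rem_def
  array_of_def list_of_def new_array_def asize_def aget_def aset_def head_def tail_def


text \<open>\<open>for_loop lo hi body s\<close> runs \<open>body i\<close> on the state for \<open>i = lo, \<dots>, hi\<close>;
  \<open>tabulate lo hi f\<close> lists the results of \<open>f i\<close> for \<open>i = lo, \<dots>, hi\<close>.\<close>

function for_loop :: "nat \<Rightarrow> nat \<Rightarrow> (nat \<Rightarrow> 's \<Rightarrow> 's timed) \<Rightarrow> 's \<Rightarrow> 's timed" where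
  "for_loop lo hi body s = do {
     go \<leftarrow> leq lo hi;
     if go then do {
       s' \<leftarrow> body lo s;
       next \<leftarrow> add lo 1;
       for_loop next hi body s'
     } else return s
   }"
  by pat_completeness auto
termination
  by (relation "measure (\<lambda>(lo, hi, _, _). Suc hi - lo)") (auto simp: timed_primitive_defs)

function tabulate :: "nat \<Rightarrow> nat \<Rightarrow> (nat \<Rightarrow> 'a timed) \<Rightarrow> 'a list timed" where
  "tabulate lo hi f = do {
     go \<leftarrow> leq lo hi;
     if go then do {
       x \<leftarrow> f lo;
       next \<leftarrow> add lo 1;
       xs \<leftarrow> tabulate next hi f;
       return (x # xs)
     } else return []
   }"
  by pat_completeness auto
termination
  by (relation "measure (\<lambda>(lo, hi, _). Suc hi - lo)") (auto simp: timed_primitive_defs)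

fun map_list :: "('a \<Rightarrow> 'b timed) \<Rightarrow> 'a list \<Rightarrow> 'b list timed" where
  "map_list f [] = do { tick; return [] }"
| "map_list f (x # xs) = do { tick; y \<leftarrow> f x; ys \<leftarrow> map_list f xs; return (y # ys) }"

fun list_size :: "'a list \<Rightarrow> nat timed" where
  "list_size [] = do { tick; return 0 }"
| "list_size (x # xs) = do { tick; n \<leftarrow> list_size xs; add n 1 }"

text \<open>\<open>ceil_log2 n\<close> computes \<open>\<lceil>log\<^sub>2 n\<rceil>\<close>, see \<open>val_ceil_log2\<close> below.\<close>

function ceil_log2 :: "nat \<Rightarrow> nat timed" where
  "ceil_log2 n = do {
     small \<leftarrow> leq n 1;
     if small then return 0
     else do { m \<leftarrow> add n 1; h \<leftarrow> quot m 2; r \<leftarrow> ceil_log2 h; add r 1 }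
   }"
  by pat_completeness auto
termination
  by (relation "measure (\<lambda>n. n)") (auto simp: timed_primitive_defs)

definition ceil_quot :: "nat \<Rightarrow> nat \<Rightarrow> nat timed" where
  "ceil_quot m n = do { n' \<leftarrow> sub n 1; s \<leftarrow> add m n'; quot s n }"

definition minimum :: "nat \<Rightarrow> nat \<Rightarrow> nat timed" where
  "minimum m n = do { b \<leftarrow> leq m n; return (if b then m else n) }"


text \<open>Merging and merge sort with respect to a comparison \<open>le\<close>.\<close>

fun merge :: "('a \<Rightarrow> 'a \<Rightarrow> bool timed) \<Rightarrow> 'a list \<Rightarrow> 'a list \<Rightarrow> 'a list timed" where
  "merge le [] ys = do { tick; return ys }"
| "merge le (x # xs) [] = do { tick; return (x # xs) }"
| "merge le (x # xs) (y # ys) = do {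
     tick;
     b \<leftarrow> le x y;
     if b then do { zs \<leftarrow> merge le xs (y # ys); return (x # zs) }
     else do { zs \<leftarrow> merge le (x # xs) ys; return (y # zs) }
   }"

fun merge_adjacent :: "('a \<Rightarrow> 'a \<Rightarrow> bool timed) \<Rightarrow> 'a list list \<Rightarrow> 'a list list timed" where
  "merge_adjacent le [] = do { tick; return [] }"
| "merge_adjacent le [xs] = do { tick; return [xs] }"
| "merge_adjacent le (xs # ys # zss) = do {
     tick;
     zs \<leftarrow> merge le xs ys;
     wss \<leftarrow> merge_adjacent le zss;
     return (zs # wss)
   }"

fun split_at :: "nat \<Rightarrow> 'a list \<Rightarrow> ('a list \<times> 'a list) timed" where
  "split_at 0 xs = do { tick; return ([], xs) }"
| "split_at (Suc n) [] = do { tick; return ([], []) }"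
| "split_at (Suc n) (x # xs) = do {
     tick;
     (ys, zs) \<leftarrow> split_at n xs;
     return (x # ys, zs)
   }"

text \<open>The first numeric argument of \<open>merge_sort\<close> is the length of the list.\<close>

function merge_sort :: "('a \<Rightarrow> 'a \<Rightarrow> bool timed) \<Rightarrow> nat \<Rightarrow> 'a list \<Rightarrow> 'a list timed" where
  "merge_sort le n xs = do {
     small \<leftarrow> leq n 1;
     if small then return xs
     else do {
       h \<leftarrow> quot n 2;
       h' \<leftarrow> sub n h;
       (ys, zs) \<leftarrow> split_at h xs;
       ys' \<leftarrow> merge_sort le h ys;
       zs' \<leftarrow> merge_sort le h' zs;
       merge le ys' zs'
     }
   }"
  by pat_completeness auto
termination
  by (relation "measure (\<lambda>(_, n, _). n)") (auto simp: timed_primitive_defs)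

text \<open>Binary search: if \<open>p\<close> is true on an initial segment of \<open>{lo<..hi}\<close> and false on the rest,
  the result is the largest index in that segment, or \<open>lo\<close> if the segment is empty.\<close>

function bin_search :: "(nat \<Rightarrow> bool timed) \<Rightarrow> nat \<Rightarrow> nat \<Rightarrow> nat timed" where
  "bin_search p lo hi = do {
     fin \<leftarrow> leq hi lo;
     if fin then return lo
     else do {
       s \<leftarrow> add lo hi;
       s' \<leftarrow> add s 1;
       m \<leftarrow> quot s' 2;
       b \<leftarrow> p m;
       if b then bin_search p m hi
       else do { hi' \<leftarrow> sub m 1; bin_search p lo hi' }
     }
   }"
  by pat_completeness auto
termination
  by (relation "measure (\<lambda>(_, lo, hi). hi - lo)") (auto simp: timed_primitive_defs)

text \<open>\<open>rank_in M y\<close> is the number of entries \<open>\<le> y\<close> of the sorted array \<open>M\<close>.\<close>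

definition rank_in :: "real array \<Rightarrow> real \<Rightarrow> nat timed" where
  "rank_in M y = do {
     m \<leftarrow> asize M;
     bin_search (\<lambda>i. do { x \<leftarrow> aget M i; leq x y }) 0 m
   }"

declare for_loop.simps [simp del] tabulate.simps [simp del] ceil_log2.simps [simp del]
  merge_sort.simps [simp del] bin_search.simps [simp del]


text \<open>
  A vector in \<open>\<real>\<^sup>d\<close> is a list of length \<open>d\<close>: its head is the first coordinate, its tail the
  subvector of the remaining coordinates, and \<open>list_all2 (\<le>)\<close> is the entrywise order.
\<close>

type_synonym vect = "real list"

fun vec_leq :: "vect \<Rightarrow> vect \<Rightarrow> bool timed" where
  "vec_leq (x # xs) (y # ys) = do { b \<leftarrow> leq x y; if b then vec_leq xs ys else return False }"
| "vec_leq xs ys = do { tick; return (xs = [] \<and> ys = []) }"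

definition first_leq :: "vect \<Rightarrow> vect \<Rightarrow> bool timed" where
  "first_leq u v = do { x \<leftarrow> head u; y \<leftarrow> head v; leq x y }"

definition second :: "vect \<Rightarrow> real timed" where
  "second v = do { u \<leftarrow> tail v; head u }"

text \<open>The two common first steps: the sorted family \<open>a\<close>, the indices \<open>k\<^sub>i\<close> and the initial
  counts \<open>c\<^sub>i\<close>.\<close>

definition sort_first :: "vect list \<Rightarrow> vect array timed" where
  "sort_first as = do {
     n \<leftarrow> list_size as;
     as' \<leftarrow> merge_sort first_leq n as;
     array_of as'
   }"

definition locate :: "vect array \<Rightarrow> vect array \<Rightarrow> (nat array \<times> nat array) timed" where
  "locate a b = do {
     na \<leftarrow> asize a;
     nb \<leftarrow> asize b;
     k \<leftarrow> new_array nb 0;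
     c \<leftarrow> new_array nb 0;
     for_loop 1 nb (\<lambda>i (k, c). do {
       bi \<leftarrow> aget b i;
       ki \<leftarrow> bin_search (\<lambda>i'. do { x \<leftarrow> aget a i'; first_leq x bi }) 0 na;
       k \<leftarrow> aset k i ki;
       none \<leftarrow> eq ki 0;
       if none then return (k, c)
       else do {
         ak \<leftarrow> aget a ki;
         dominated \<leftarrow> vec_leq ak bi;
         c \<leftarrow> aset c i (if dominated then 1 else 0);
         return (k, c)
       }
     }) (k, c)
   }"

text \<open>The even \<open>\<ell>\<close> with \<open>w (\<ell> - 1) < k \<le> w \<ell>\<close>, if there is one and \<open>k > 1\<close>; see \<open>val_even_block\<close>
  below.\<close>

definition even_block :: "nat \<Rightarrow> nat \<Rightarrow> nat option timed" where
  "even_block w k = do {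
     skip \<leftarrow> leq k 1;
     if skip then return None
     else do {
       k' \<leftarrow> sub k 1;
       q \<leftarrow> quot k' w;
       l \<leftarrow> add q 1;
       r \<leftarrow> rem l 2;
       ev \<leftarrow> eq r 0;
       return (if ev then Some l else None)
     }
   }"

text \<open>In both algorithms the loop over \<open>j\<close> carries \<open>w = 2\<^sup>j\<^sup>-\<^sup>1\<close> along.\<close>

definition algorithm_A :: "vect list \<Rightarrow> vect list \<Rightarrow> nat list timed" where
  "algorithm_A as bs = do {
     a \<leftarrow> sort_first as;
     b \<leftarrow> array_of bs;
     na \<leftarrow> asize a;
     nb \<leftarrow> asize b;
     (k, c) \<leftarrow> locate a b;
     levels \<leftarrow> ceil_log2 na;
     (_, _, c) \<leftarrow> for_loop 1 levels (\<lambda>j (w, es, c). do {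
       start \<leftarrow> eq j 1;
       es \<leftarrow> (if start
              then tabulate 1 na (\<lambda>i. do { ai \<leftarrow> aget a i; x \<leftarrow> second ai; return [x] })
              else merge_adjacent leq es);
       arrays \<leftarrow> map_list array_of es;
       e \<leftarrow> array_of arrays;
       c \<leftarrow> for_loop 1 nb (\<lambda>i c. do {
         ki \<leftarrow> aget k i;
         block \<leftarrow> even_block w ki;
         case block of
           None \<Rightarrow> return c
         | Some l \<Rightarrow> do {
             l' \<leftarrow> sub l 1;
             el \<leftarrow> aget e l';
             bi \<leftarrow> aget b i;
             y \<leftarrow> second bi;
             r \<leftarrow> rank_in el y;
             ci \<leftarrow> aget c i;
             ci' \<leftarrow> add ci r;
             aset c i ci'
           }
       }) c;
       w \<leftarrow> add w w;
       return (w, es, c)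
     }) (1, [], c);
     list_of c
   }"

fun add_ranks :: "nat list \<Rightarrow> nat list \<Rightarrow> nat array \<Rightarrow> nat array timed" where
  "add_ranks (i # is) (r # rs) c = do {
     tick;
     ci \<leftarrow> aget c i;
     ci' \<leftarrow> add ci r;
     c \<leftarrow> aset c i ci';
     add_ranks is rs c
   }"
| "add_ranks is rs c = do { tick; return c }"

text \<open>One round of the higher-dimensional algorithm, where \<open>subroutine\<close> is the algorithm applied
  in dimension \<open>d - 1\<close>.  The sets \<open>\<B>\<close> and \<open>\<C>\<close> are stored as parallel lists.\<close>

definition algorithm_B_with ::
  "(vect list \<Rightarrow> vect list \<Rightarrow> nat list timed) \<Rightarrow> vect list \<Rightarrow> vect list \<Rightarrow> nat list timed" where
  "algorithm_B_with subroutine as bs = do {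
     a \<leftarrow> sort_first as;
     b \<leftarrow> array_of bs;
     na \<leftarrow> asize a;
     nb \<leftarrow> asize b;
     (k, c) \<leftarrow> locate a b;
     levels \<leftarrow> ceil_log2 na;
     (_, c) \<leftarrow> for_loop 1 levels (\<lambda>j (w, c). do {
       J \<leftarrow> ceil_quot na w;
       As \<leftarrow> tabulate 1 J (\<lambda>j'. do {
         hi \<leftarrow> mult w j';
         lo \<leftarrow> sub hi w;
         lo \<leftarrow> add lo 1;
         hi \<leftarrow> minimum hi na;
         tabulate lo hi (\<lambda>i. do { ai \<leftarrow> aget a i; tail ai })
       });
       \<A> \<leftarrow> array_of As;
       \<B> \<leftarrow> new_array J [];
       \<C> \<leftarrow> new_array J [];
       (\<B>, \<C>) \<leftarrow> for_loop 1 nb (\<lambda>i (\<B>, \<C>). do {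
         ki \<leftarrow> aget k i;
         block \<leftarrow> even_block w ki;
         case block of
           None \<Rightarrow> return (\<B>, \<C>)
         | Some l \<Rightarrow> do {
             l' \<leftarrow> sub l 1;
             bi \<leftarrow> aget b i;
             v \<leftarrow> tail bi;
             vs \<leftarrow> aget \<B> l';
             \<B> \<leftarrow> aset \<B> l' (v # vs);
             is \<leftarrow> aget \<C> l';
             \<C> \<leftarrow> aset \<C> l' (i # is);
             return (\<B>, \<C>)
           }
       }) (\<B>, \<C>);
       c \<leftarrow> for_loop 1 J (\<lambda>j' c. do {
         us \<leftarrow> aget \<A> j';
         vs \<leftarrow> aget \<B> j';
         is \<leftarrow> aget \<C> j';
         rs \<leftarrow> subroutine us vs;
         add_ranks is rs c
       }) c;
       w \<leftarrow> add w w;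
       return (w, c)
     }) (1, c);
     list_of c
   }"

text \<open>The parameter \<open>d\<close> is the dimension; only \<open>d \<ge> 3\<close> is meaningful.\<close>

fun algorithm_B :: "nat \<Rightarrow> vect list \<Rightarrow> vect list \<Rightarrow> nat list timed" where
  "algorithm_B d =
     algorithm_B_with (if d \<le> 3 then algorithm_A else algorithm_B (d - 1))"

declare algorithm_B.simps [simp del]


lemma val_ceil_log2: "val (ceil_log2 n) = nat \<lceil>log 2 (real n)\<rceil>"
proof (induction n rule: ceil_log2.induct)
  case (1 n)
  show ?case
  proof (cases "n \<le> 1")
    case True
    then have "n = 0 \<or> n = 1" by auto
    then show ?thesis
      by (auto simp: ceil_log2.simps[of n] ceil_log2.simps[of 0] timed_primitive_defs log_def)
  next
    case False
    then have n: "n \<ge> 2" by simp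
    have h: "(n + 1) div 2 = (n - 1) div 2 + 1" using n by presburger
    have IH: "val (ceil_log2 ((n + 1) div 2)) = nat \<lceil>log 2 (real ((n + 1) div 2))\<rceil>"
      using 1[of False "n + 1" "(n + 1) div 2"] False by (simp add: timed_primitive_defs)
    have "val (ceil_log2 n) = val (ceil_log2 ((n + 1) div 2)) + 1"
      using False by (simp add: ceil_log2.simps[of n] timed_primitive_defs)
    also have "\<dots> = nat (\<lceil>log 2 (real ((n - 1) div 2 + 1))\<rceil> + 1)"
    proof -
      have "0 \<le> log 2 (real ((n - 1) div 2 + 1))" by simp
      then have "0 \<le> \<lceil>log 2 (real ((n - 1) div 2 + 1))\<rceil>" by linarith
      then show ?thesis using IH h by (simp add: nat_add_distrib)
    qed
    also have "\<dots> = nat \<lceil>log 2 (real n)\<rceil>"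
      using ceiling_log2_div2[OF n] by simp
    finally show ?thesis .
  qed
qed

lemma val_even_block:
  assumes "w > 0"
  shows "val (even_block w k) = Some l \<longleftrightarrow> 1 < k \<and> even l \<and> w * (l - 1) < k \<and> k \<le> w * l"
proof (cases "k \<le> 1")
  case True
  then show ?thesis by (auto simp: even_block_def timed_primitive_defs)
next
  case False
  then have "l = (k - 1) div w + 1 \<longleftrightarrow> w * (l - 1) < k \<and> k \<le> w * l"
  proof (cases l)
    case (Suc m)
    have "m = (k - 1) div w \<longleftrightarrow> w * m \<le> k - 1 \<and> k - 1 < w * Suc m"
      using assms by (metis div_nat_eqI dividend_less_times_div mult_Suc_right times_div_less_eq_dividend)
    moreover have "w * m \<le> k - 1 \<longleftrightarrow> w * m < k" "k - 1 < w * Suc m \<longleftrightarrow> k \<le> w * Suc m"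
      using False by arith+
    ultimately show ?thesis using Suc by simp
  qed auto
  then show ?thesis
    using False by (auto simp: even_block_def timed_primitive_defs even_iff_mod_2_eq_zero)
qed

end

theory Submission
  imports Defs "HOL-Library.Multiset"
begin

text \<open>
  Once the family \<open>a\<close> is sorted by first coordinate, the vectors whose first coordinate is at most
  that of a query \<open>b\<close> form the prefix \<open>a\<^sub>1, \<dots>, a\<^sub>k\<close>.  Inside this prefix the first coordinate no
  longer matters: the vectors to be counted are those dominated by \<open>b\<close> in the remaining
  coordinates.  The initial value of the counter accounts for \<open>a\<^sub>k\<close>.  The other \<open>k - 1\<close> positions
  are cut up along the binary expansion of \<open>k - 1\<close>: for each digit \<open>1\<close>, of weight
  \<open>w = 2\<^sup>j\<^sup>-\<^sup>1\<close>, there is one aligned block of length \<open>w\<close>, and the condition on an even \<open>\<ell>\<close> at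
  level \<open>j\<close> tests exactly whether that digit is \<open>1\<close>, in which case \<open>\<ell> - 1\<close> is the number of the
  block.  All digits are reached because
  \<open>k - 1 < n\<^sub>a\<close> and there are \<open>\<lceil>log\<^sub>2 n\<^sub>a\<rceil>\<close> levels.  This is
  \<open>length_filter_dyadic_parts\<close>, from which \<open>dominated_eq_initial_plus_levels\<close> derives correctness
  of both algorithms at once: each only has to add, at every level, the count over the block of that
  level in one dimension less.  In dimension one that count is a rank in a sorted array; in higher
  dimensions it is delegated to the recursive call.

  For the running time let \<open>N = n\<^sub>a + n\<^sub>b + 1\<close> and \<open>L = \<lceil>log\<^sub>2 n\<^sub>a\<rceil> + 1\<close>.  Sorting and the binary searches
  of the first two steps cost \<open>O(N L)\<close>, and there are fewer than \<open>L\<close> levels.  A level of algorithm A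
  costs \<open>O(N)\<close> for the merging and \<open>O(L)\<close> per query for its rank, so the total is \<open>O(N L\<^sup>2)\<close>.
  A level of algorithm B splits \<open>a\<close> into disjoint blocks and sends each query to at most one of
  them.  A bound \<open>K N L\<^sup>d\<close> for the subroutine is linear in the sizes, so summing it over the blocks
  of a level gives at most \<open>2 K N L\<^sup>d\<close>, and multiplying by the number of levels raises the
  exponent by one (\<open>algorithm_B_with_ranks_within\<close>).  Induction on the dimension concludes.

  Correctness and cost are proved together (\<open>for_loop_invariant\<close>, \<open>ranks_within\<close>), since the sizes that
  determine the cost of an iteration are known only from the invariant that describes its state.
\<close>

section \<open>Values and costs of timed computations\<close>

lemma val_bind [simp]: "val (bind_timed m f) = val (f (val m))"
  and time_bind [simp]: "time (bind_timed m f) = time m + time (f (val m))"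
  by (simp_all add: bind_timed_def)

lemma primitive_val_time [simp]:
  "val (return x) = x" "time (return x) = 0"
  "time tick = 1"
  "val (leq p q) = (p \<le> q)" "time (leq p q) = 1"
  "val (eq m n) = (m = n)" "time (eq m n) = 1"
  "val (add m n) = m + n" "time (add m n) = 1"
  "val (sub m n) = m - n" "time (sub m n) = 1"
  "val (Defs.mult m n) = m * n" "time (Defs.mult m n) = 1"
  "val (quot m n) = m div n" "time (quot m n) = 1"
  "val (rem m n) = m mod n" "time (rem m n) = 1"
  "val (array_of xs) = Array xs" "time (array_of xs) = length xs + 1"
  "val (list_of M) = elems M" "time (list_of M) = length (elems M) + 1"
  "val (new_array n x) = Array (replicate n x)" "time (new_array n x) = n + 1"
  "val (asize M) = length (elems M)" "time (asize M) = 1"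
  "val (aget M i) = elems M ! (i - 1)" "time (aget M i) = 1"
  "val (aset M i x) = Array ((elems M)[i - 1 := x])" "time (aset M i x) = 1"
  "val (head xs) = hd xs" "time (head xs) = 1"
  "val (tail xs) = tl xs" "time (tail xs) = 1"
  by (simp_all add: timed_primitive_defs)

text \<open>The cost \<open>C i\<close> of an iteration may use the invariant, and may vary with \<open>i\<close>: the
  iterations over the blocks of a level have very different costs, of which only the sum is small.\<close>

lemma for_loop_invariant:
  assumes "lo \<le> Suc hi" "I lo s"
    and "\<And>i s. lo \<le> i \<Longrightarrow> i \<le> hi \<Longrightarrow> I i s \<Longrightarrow>
           I (Suc i) (val (body i s)) \<and> time (body i s) \<le> C i"
  shows "I (Suc hi) (val (for_loop lo hi body s)) \<and>
         time (for_loop lo hi body s) \<le> 1 + (\<Sum>i=lo..hi. C i + 2)"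
  using assms
proof (induction "Suc hi - lo" arbitrary: lo s)
  case 0
  then have "lo = Suc hi" by simp
  with 0 show ?case by (simp add: for_loop.simps[of "Suc hi"])
next
  case (Suc m)
  then have lo: "lo \<le> hi" by simp
  have step: "I (Suc lo) (val (body lo s)) \<and> time (body lo s) \<le> C lo"
    using Suc.prems lo by blast
  have "I (Suc hi) (val (for_loop (Suc lo) hi body (val (body lo s)))) \<and>
        time (for_loop (Suc lo) hi body (val (body lo s))) \<le> 1 + (\<Sum>i=Suc lo..hi. C i + 2)"
    by (rule Suc.hyps(1)) (use Suc.hyps(2) Suc.prems lo step in auto)
  with lo step show ?case
    by (simp add: for_loop.simps[of lo] sum.atLeast_Suc_atMost[of lo hi])
qed

lemma tabulate_val_time:
  "val (tabulate lo hi f) = map (\<lambda>i. val (f i)) [lo..<Suc hi]"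
  "time (tabulate lo hi f) = 1 + (\<Sum>i=lo..hi. time (f i) + 2)"
proof (induction lo hi f rule: tabulate.induct)
  case (1 lo hi f)
  have "val (tabulate lo hi f) = map (\<lambda>i. val (f i)) [lo..<Suc hi] \<and>
        time (tabulate lo hi f) = 1 + (\<Sum>i=lo..hi. time (f i) + 2)"
  proof (cases "lo \<le> hi")
    case True
    then show ?thesis
      using 1[of True "val (f lo)" "lo + 1"]
      by (simp add: tabulate.simps[of lo] upt_conv_Cons sum.atLeast_Suc_atMost[of lo hi]
          del: upt_Suc)
  next
    case False
    then show ?thesis by (simp add: tabulate.simps[of lo])
  qed
  then show "val (tabulate lo hi f) = map (\<lambda>i. val (f i)) [lo..<Suc hi]"
    and "time (tabulate lo hi f) = 1 + (\<Sum>i=lo..hi. time (f i) + 2)" by blast+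
qed

lemma map_list_val_time:
  "val (map_list f xs) = map (\<lambda>x. val (f x)) xs"
  "time (map_list f xs) = 1 + (\<Sum>x\<leftarrow>xs. time (f x) + 1)"
  by (induction xs) simp_all

lemma list_size_val_time:
  "val (list_size xs) = length xs" "time (list_size xs) = 2 * length xs + 1"
  by (induction xs) simp_all

lemma minimum_val_time [simp]: "val (minimum m n) = min m n" "time (minimum m n) = 1"
  by (simp_all add: minimum_def)

lemma ceil_quot_val_time [simp]:
  "val (ceil_quot m n) = (m + (n - 1)) div n" "time (ceil_quot m n) = 3"
  by (simp_all add: ceil_quot_def)

lemma vec_leq_val_time:
  "val (vec_leq u v) = list_all2 (\<le>) u v" "time (vec_leq u v) \<le> length u + 1"
  by (induction u v rule: vec_leq.induct) auto

lemma first_leq_val_time [simp]: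
  "val (first_leq u v) = (hd u \<le> hd v)" "time (first_leq u v) = 3"
  by (simp_all add: first_leq_def)

lemma second_val_time [simp]: "val (second v) = hd (tl v)" "time (second v) = 2"
  by (simp_all add: second_def)

section \<open>The number of halving steps\<close>

abbreviation clog :: "nat \<Rightarrow> nat" where
  "clog n \<equiv> val (ceil_log2 n)"

lemma clog_small [simp]: "n \<le> 1 \<Longrightarrow> clog n = 0"
  by (simp add: ceil_log2.simps[of n])

lemma clog_step: "2 \<le> n \<Longrightarrow> clog n = Suc (clog ((n + 1) div 2))"
  by (simp add: ceil_log2.simps[of n])

lemma clog_mono: "m \<le> n \<Longrightarrow> clog m \<le> clog n"
proof (induction n arbitrary: m rule: less_induct)
  case (less n)
  show ?case
  proof (cases "m \<le> 1")
    case False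
    then have "clog ((m + 1) div 2) \<le> clog ((n + 1) div 2)"
      using less.prems by (intro less.IH) auto
    then show ?thesis using False less.prems by (simp add: clog_step)
  qed simp
qed

text \<open>Halving with either rounding loses at least one level.  This is the step of the
  recurrences for merge sort and binary search.\<close>

lemma clog_half:
  assumes "2 \<le> n" "m \<le> (n + 1) div 2"
  shows "Suc (clog m) \<le> clog n"
  using assms clog_mono[OF assms(2)] clog_step[OF assms(1)] by simp

lemma le_two_power_clog: "n \<le> 2 ^ clog n"
proof (induction n rule: less_induct)
  case (less n)
  show ?case
  proof (cases "n \<le> 1")
    case False
    then have "(n + 1) div 2 \<le> 2 ^ clog ((n + 1) div 2)" by (intro less.IH) auto
    moreover have "n \<le> 2 * ((n + 1) div 2)" by simp
    ultimately show ?thesis using False by (simp add: clog_step)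
  qed simp
qed

lemma time_ceil_log2: "time (ceil_log2 n) \<le> 4 * clog n + 1"
proof (induction n rule: less_induct)
  case (less n)
  show ?case
  proof (cases "n \<le> 1")
    case True
    then show ?thesis by (simp add: ceil_log2.simps[of n])
  next
    case False
    then have "time (ceil_log2 ((n + 1) div 2)) \<le> 4 * clog ((n + 1) div 2) + 1"
      by (intro less.IH) auto
    then show ?thesis using False by (simp add: ceil_log2.simps[of n])
  qed
qed

section \<open>Sorting and searching\<close>

lemma set_merge: "set (val (merge le xs ys)) = set xs \<union> set ys"
  by (induction le xs ys rule: merge.induct) auto

lemma mset_merge: "mset (val (merge le xs ys)) = mset xs + mset ys"
  by (induction le xs ys rule: merge.induct) auto

lemma sorted_merge:
  assumes "\<And>x y. val (le x y) = (key x \<le> key y)"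
    and "sorted (map key xs)" "sorted (map key ys)"
  shows "sorted (map key (val (merge le xs ys)))"
  using assms
proof (induction le xs ys rule: merge.induct)
  case (3 le x xs y ys)
  show ?case
  proof (cases "key x \<le> key y")
    case True
    then have "sorted (map key (val (merge le xs (y # ys))))" using 3 by simp
    then show ?thesis using True 3 by (force simp: set_merge)
  next
    case False
    then have "sorted (map key (val (merge le (x # xs) ys)))" using 3 by simp
    then show ?thesis using False 3 by (force simp: set_merge)
  qed
qed simp_all

lemma time_merge:
  assumes "\<And>x y. time (le x y) \<le> c"
  shows "time (merge le xs ys) \<le> (c + 1) * (length xs + length ys) + 1"
  using assms
proof (induction le xs ys rule: merge.induct)
  case (3 le x xs y ys)
  have "time (le x y) \<le> c" by (rule 3)
  moreover have "time (merge le xs (y # ys)) \<le> (c + 1) * (length xs + length (y # ys)) + 1"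
    if "val (le x y)" using 3 that by blast
  moreover have "time (merge le (x # xs) ys) \<le> (c + 1) * (length (x # xs) + length ys) + 1"
    if "\<not> val (le x y)" using 3 that by blast
  ultimately show ?case by (auto simp: algebra_simps)
qed simp_all

lemma split_at_val_time:
  "val (split_at h xs) = (take h xs, drop h xs)"
  "time (split_at h xs) \<le> h + 1"
  by (induction h xs rule: split_at.induct) (auto simp: case_prod_beta)

lemma merge_sort_val:
  assumes "\<And>x y. val (le x y) = (key x \<le> key y)" "n = length xs"
  shows "mset (val (merge_sort le n xs)) = mset xs \<and> sorted (map key (val (merge_sort le n xs)))"
  using assms(2)
proof (induction n arbitrary: xs rule: less_induct)
  case (less n)
  show ?case
  proof (cases "n \<le> 1")
    case True
    then show ?thesis using less.prems
      by (cases xs) (auto simp: merge_sort.simps[of le 0] merge_sort.simps[of le "Suc 0"])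
  next
    case False
    define h where "h = n div 2"
    let ?ys = "val (merge_sort le h (take h xs))"
    let ?zs = "val (merge_sort le (n - h) (drop h xs))"
    have h: "h < n" "n - h < n" using False by (auto simp: h_def)
    have "mset ?ys = mset (take h xs) \<and> sorted (map key ?ys)"
         "mset ?zs = mset (drop h xs) \<and> sorted (map key ?zs)"
      using less.IH[OF h(1), of "take h xs"] less.IH[OF h(2), of "drop h xs"] less.prems h by auto
    moreover have "val (merge_sort le n xs) = val (merge le ?ys ?zs)"
      using False by (simp add: merge_sort.simps[of le n] split_at_val_time h_def)
    moreover have "mset (take h xs) + mset (drop h xs) = mset xs"
      by (metis append_take_drop_id mset_append)
    ultimately show ?thesis by (simp add: mset_merge sorted_merge[OF assms(1)])
  qed
qed

text \<open>The recurrence is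
  \<open>T(n) = T(\<lfloor>n/2\<rfloor>) + T(\<lceil>n/2\<rceil>) + O(n)\<close>.  Both halves have one level less, so the two recursive
  bounds add up to \<open>(c + 5) n (clog n - 1) + 2\<close>; the missing \<open>(c + 5) n\<close> pays for the splitting,
  the merging and the constants.  The key enters only because the merged lists must be known to have
  the lengths of the halves.\<close>

lemma time_merge_sort:
  fixes key :: "'a \<Rightarrow> 'b::linorder"
  assumes "\<And>x y. time (le x y) \<le> c" "\<And>x y. val (le x y) = (key x \<le> key y)" "n = length xs"
  shows "time (merge_sort le n xs) \<le> (c + 5) * n * clog n + 1"
  using assms(3)
proof (induction n arbitrary: xs rule: less_induct)
  case (less n)
  show ?case
  proof (cases "n \<le> 1")
    case True
    then show ?thesis by (simp add: merge_sort.simps[of le n])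
  next
    case False
    define h where "h = n div 2"
    obtain l where l: "clog n = Suc l" using clog_step[of n] False by auto
    let ?ys = "val (merge_sort le h (take h xs))"
    let ?zs = "val (merge_sort le (n - h) (drop h xs))"
    have h: "h < n" "n - h < n" using False by (auto simp: h_def)
    have len: "h = length (take h xs)" "n - h = length (drop h xs)" using less.prems h by auto
    have "mset ?ys = mset (take h xs)" "mset ?zs = mset (drop h xs)"
      using merge_sort_val[of le key, OF assms(2) len(1)]
        merge_sort_val[of le key, OF assms(2) len(2)] by auto
    then have lens: "length ?ys + length ?zs = n"
      using len h by (metis mset_eq_length add_diff_inverse_nat less_imp_le not_less)
    have "clog h \<le> l" "clog (n - h) \<le> l"
      using clog_half[of n h] clog_half[of n "n - h"] False l by (auto simp: h_def)
    then have "(c + 5) * h * clog h + (c + 5) * (n - h) * clog (n - h)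
             \<le> (c + 5) * h * l + (c + 5) * (n - h) * l"
      by (intro add_mono mult_left_mono) auto
    also have "\<dots> = (c + 5) * n * l"
      using h by (simp add: add_mult_distrib[symmetric] add_mult_distrib2[symmetric])
    finally have rec: "time (merge_sort le h (take h xs)) +
        time (merge_sort le (n - h) (drop h xs)) \<le> (c + 5) * n * l + 2"
      using less.IH[OF h(1) len(1)] less.IH[OF h(2) len(2)] by linarith
    have "time (merge le ?ys ?zs) \<le> (c + 1) * n + 1"
      using time_merge[of le c ?ys ?zs] assms(1) lens by simp
    moreover have "time (merge_sort le n xs) = 3 + time (split_at h xs) +
        (time (merge_sort le h (take h xs)) + time (merge_sort le (n - h) (drop h xs))) +
        time (merge le ?ys ?zs)"
      using False by (simp add: merge_sort.simps[of le n] split_at_val_time h_def)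
    ultimately have "time (merge_sort le n xs) \<le> (c + 5) * n * l + (c + 1) * n + h + 7"
      using rec split_at_val_time(2)[of h xs] by linarith
    also have "\<dots> \<le> (c + 5) * n * clog n + 1"
      using False l h by (simp add: algebra_simps)
    finally show ?thesis .
  qed
qed

lemma bin_search_val:
  assumes "lo \<le> r" "r \<le> hi" "\<And>i. lo < i \<Longrightarrow> i \<le> hi \<Longrightarrow> val (p i) = (i \<le> r)"
  shows "val (bin_search p lo hi) = r"
  using assms
proof (induction "hi - lo" arbitrary: lo hi rule: less_induct)
  case less
  show ?case
  proof (cases "hi \<le> lo")
    case True
    then show ?thesis using less.prems by (simp add: bin_search.simps[of p lo hi])
  next
    case False
    define m where "m = (lo + hi + 1) div 2"
    have m: "lo < m" "m \<le> hi" using False by (auto simp: m_def)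
    then have pm: "val (p m) = (m \<le> r)" using less.prems by blast
    show ?thesis
    proof (cases "m \<le> r")
      case True
      then have "val (bin_search p m hi) = r"
        using less.prems m by (intro less.hyps) auto
      then show ?thesis using True False pm by (simp add: bin_search.simps[of p lo hi] m_def)
    next
      case ge: False
      then have "val (bin_search p lo (m - 1)) = r"
        using less.prems m by (intro less.hyps) auto
      then show ?thesis using ge False pm by (simp add: bin_search.simps[of p lo hi] m_def)
    qed
  qed
qed

lemma time_bin_search:
  assumes "\<And>i. time (p i) \<le> c"
  shows "time (bin_search p lo hi) \<le> (c + 5) * (clog (hi - lo) + 1) + 1"
proof (induction "hi - lo" arbitrary: lo hi rule: less_induct)
  case less
  show ?case
  proof (cases "hi \<le> lo")
    case True
    then show ?thesis by (simp add: bin_search.simps[of p lo hi])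
  next
    case False
    define m where "m = (lo + hi + 1) div 2"
    define t where "t = (if val (p m) then time (bin_search p m hi)
                         else 1 + time (bin_search p lo (m - 1)))"
    have m: "lo < m" "m \<le> hi" using False by (auto simp: m_def)
    have unfold: "time (bin_search p lo hi) = 4 + time (p m) + t"
      using False by (simp add: bin_search.simps[of p lo hi] m_def t_def)
    have IH: "time (bin_search p m hi) \<le> (c + 5) * (clog (hi - m) + 1) + 1"
      by (rule less.hyps) (use m in auto)
    have IH': "time (bin_search p lo (m - 1)) \<le> (c + 5) * (clog (m - 1 - lo) + 1) + 1"
      by (rule less.hyps) (use m in auto)
    \<comment> \<open>An interval of length one has no level to lose, but its search ends after this step.\<close>
    show ?thesis
    proof (cases "hi - lo = 1")
      case True
      then have "hi - m = 0" "m - 1 - lo = 0" by (auto simp: m_def)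
      then have "m = hi" "m - 1 = lo" using m by auto
      then have "t \<le> 2" by (simp add: t_def bin_search.simps[of p _ hi] bin_search.simps[of p _ lo])
      then show ?thesis using True unfold assms[of m] by simp
    next
      case big: False
      have "Suc (clog (hi - m)) \<le> clog (hi - lo)" "Suc (clog (m - 1 - lo)) \<le> clog (hi - lo)"
        using False big by (auto intro!: clog_half simp: m_def)
      then have "(c + 5) * (clog (hi - m) + 1) \<le> (c + 5) * clog (hi - lo)"
        "(c + 5) * (clog (m - 1 - lo) + 1) \<le> (c + 5) * clog (hi - lo)"
        by (auto intro: mult_left_mono simp del: mult_Suc_right)
      then have "t \<le> (c + 5) * clog (hi - lo) + 2"
        using IH IH' by (simp add: t_def)
      then show ?thesis using unfold assms[of m] by (simp add: algebra_simps)
    qed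
  qed
qed

text \<open>The predicates given to the binary search hold on an initial segment because the entries below
  a threshold form a prefix of a sorted list; the index found is therefore a count.\<close>

lemma sorted_nth_le_iff:
  assumes "sorted (map f xs)" "i < length xs"
  shows "f (xs ! i) \<le> y \<longleftrightarrow> i < length (filter (\<lambda>x. f x \<le> y) xs)"
  using assms
proof (induction xs arbitrary: i)
  case (Cons x xs)
  have none: "filter (\<lambda>x. f x \<le> y) xs = []" if "\<not> f x \<le> y"
    using Cons.prems that by (force simp: filter_empty_conv)
  show ?case
  proof (cases i)
    case 0
    then show ?thesis using none by auto
  next
    case (Suc j)
    then show ?thesis using Cons none by (auto dest: order_trans)
  qed
qed simp

lemma rank_in_val_time:
  "sorted (elems M) \<Longrightarrow> val (rank_in M y) = length (filter (\<lambda>x. x \<le> y) (elems M))"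
  "time (rank_in M y) \<le> 7 * (clog (length (elems M)) + 1) + 2"
proof -
  show "val (rank_in M y) = length (filter (\<lambda>x. x \<le> y) (elems M))" if "sorted (elems M)"
    unfolding rank_in_def using that sorted_nth_le_iff[of "\<lambda>x. x" "elems M"]
    by (auto intro!: bin_search_val)
  show "time (rank_in M y) \<le> 7 * (clog (length (elems M)) + 1) + 2"
    using time_bin_search[of "\<lambda>i. bind_timed (aget M i) (\<lambda>x. leq x y)" 2 0 "length (elems M)"]
    by (simp add: rank_in_def)
qed

section \<open>Consecutive chunks and the dyadic decomposition of a prefix\<close>

text \<open>The consecutive blocks of length \<open>w\<close>, the last one possibly shorter.  The recursive form
  matches the way in which neighbouring blocks are merged; \<open>nth_chunks\<close> gives the description by
  positions.\<close>

function chunks :: "nat \<Rightarrow> 'a list \<Rightarrow> 'a list list" where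
  "chunks w xs = (if w = 0 \<or> xs = [] then [] else take w xs # chunks w (drop w xs))"
  by pat_completeness auto
termination by (relation "measure (\<lambda>(_, xs). length xs)") auto

declare chunks.simps [simp del]

lemma chunks_Nil [simp]: "chunks w [] = []"
  by (simp add: chunks.simps)

lemma chunks_short: "xs \<noteq> [] \<Longrightarrow> length xs \<le> w \<Longrightarrow> chunks w xs = [xs]"
  by (cases "w = 0") (simp_all add: chunks.simps[of w xs])

lemma map_chunks: "map (map f) (chunks w xs) = chunks w (map f xs)"
proof (induction w xs rule: chunks.induct)
  case (1 w xs)
  then show ?case
    by (cases "w = 0 \<or> xs = []") (auto simp: chunks.simps[of w xs] chunks.simps[of w "map f xs"] take_map drop_map)
qed

lemma length_chunks: "0 < w \<Longrightarrow> length (chunks w xs) = (length xs + (w - 1)) div w"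
proof (induction w xs rule: chunks.induct)
  case (1 w xs)
  show ?case
  proof (cases "xs = []")
    case False
    then have IH: "length (chunks w (drop w xs)) = (length (drop w xs) + (w - 1)) div w"
      using 1 by simp
    have "(length xs + (w - 1)) div w = Suc ((length (drop w xs) + (w - 1)) div w)"
    proof (cases "length xs \<le> w")
      case True
      then show ?thesis using False 1(2)
        by (intro div_nat_eqI; cases xs) auto
    next
      case False
      then have "length xs + (w - 1) = (length (drop w xs) + (w - 1)) + w" by simp
      then show ?thesis using 1(2) by (simp only: div_add_self2)
    qed
    then show ?thesis using IH False 1(2) by (simp add: chunks.simps[of w xs])
  qed (use 1 in simp)
qed

lemma nth_chunks: "q < length (chunks w xs) \<Longrightarrow> chunks w xs ! q = take w (drop (w * q) xs)"
proof (induction w xs arbitrary: q rule: chunks.induct)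
  case (1 w xs)
  then have *: "\<not> (w = 0 \<or> xs = [])"
    by (simp add: chunks.simps[of w xs] split: if_splits)
  then show ?case using 1
    by (cases q) (auto simp: chunks.simps[of w xs] algebra_simps)
qed

lemma sum_length_chunks: "0 < w \<Longrightarrow> (\<Sum>ys\<leftarrow>chunks w xs. length ys) = length xs"
proof (induction w xs rule: chunks.induct)
  case (1 w xs)
  then show ?case by (cases "xs = []") (auto simp: chunks.simps[of w xs])
qed

lemma set_chunks: "xs \<in> set (chunks w ys) \<Longrightarrow> set xs \<subseteq> set ys"
proof (induction w ys rule: chunks.induct)
  case (1 w ys)
  then show ?case
    by (auto simp: chunks.simps[of w ys] split: if_splits dest: in_set_takeD in_set_dropD)
qed

lemma length_chunks_le: "length (chunks w xs) \<le> length xs"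
proof (induction w xs rule: chunks.induct)
  case (1 w xs)
  then show ?case
    by (cases xs; cases w) (auto simp: chunks.simps[of _ "_ # _"])
qed

lemma chunks_1: "chunks (Suc 0) xs = map (\<lambda>x. [x]) xs"
  by (induction xs) (simp_all add: chunks.simps[of "Suc 0" "_ # _"])

lemma chunks_double:
  "w < length xs \<Longrightarrow> 0 < w \<Longrightarrow>
    chunks w xs = take w xs # take w (drop w xs) # chunks w (drop (2 * w) xs)"
  by (cases "xs = []") (simp_all add: chunks.simps[of w xs] chunks.simps[of w "drop w xs"] mult_2)

lemma sort_by_merge: "val (merge leq (sort xs) (sort ys)) = sort (xs @ ys)"
  by (rule properties_for_sort[symmetric])
    (use sorted_merge[of leq "\<lambda>x. x" "sort xs" "sort ys"] in \<open>auto simp: mset_merge\<close>)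

text \<open>A round of pairwise merging turns the sorted blocks of one level into those of the next,
  also when an odd block is left over at the end, which is then already a block of the next level.\<close>

lemma merge_adjacent_chunks:
  assumes "0 < w"
  shows "val (merge_adjacent leq (map sort (chunks w xs))) = map sort (chunks (2 * w) xs)"
  using assms
proof (induction "2 * w" xs rule: chunks.induct)
  case (1 xs)
  consider "xs = []" | "xs \<noteq> []" "length xs \<le> w" | "w < length xs" by linarith
  then show ?case
  proof cases
    case 2
    then show ?thesis by (simp add: chunks_short)
  next
    case 3
    then have "val (merge_adjacent leq (map sort (chunks w (drop (2 * w) xs)))) =
        map sort (chunks (2 * w) (drop (2 * w) xs))"
      using 1 by (cases "xs = []") auto
    moreover have "take w xs @ take w (drop w xs) = take (2 * w) xs"
      by (simp add: take_add mult_2)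
    ultimately show ?thesis
      using 3 1(2) chunks_double[OF 3 1(2)]
      by (simp add: chunks.simps[of "2 * w" xs] sort_by_merge) auto
  qed simp
qed

lemma time_merge_adjacent:
  "time (merge_adjacent leq xss) \<le> 2 * (\<Sum>xs\<leftarrow>xss. length xs) + 2 * length xss + 1"
proof (induction "leq :: 'a::linorder \<Rightarrow> 'a \<Rightarrow> bool timed" xss rule: merge_adjacent.induct)
  case (3 xs ys zss)
  have "time (merge leq xs ys) \<le> 2 * (length xs + length ys) + 1"
    using time_merge[of leq 1 xs ys] by (simp add: numeral_2_eq_2)
  with 3 show ?case by simp
qed simp_all

text \<open>The block that contributes to a query with index \<open>k\<close> at the level of block length \<open>w\<close>.  The
  even \<open>\<ell>\<close> with \<open>w (\<ell> - 1) < k \<le> w \<ell>\<close> exists iff \<open>q = (k - 1) div w\<close> is odd, and then \<open>\<ell> = q + 1\<close>,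
  so block number \<open>\<ell> - 1 = q\<close> starts after \<open>w (q - 1)\<close> entries.  For \<open>k \<le> 1\<close> the quotient is \<open>0\<close>,
  which is even: the case that the algorithms skip yields the empty block.\<close>

definition dyadic_part :: "nat \<Rightarrow> nat \<Rightarrow> 'a list \<Rightarrow> 'a list" where
  "dyadic_part w k xs =
     (let q = (k - 1) div w in if odd q then take w (drop (w * (q - 1)) xs) else [])"

lemma dyadic_part_eq_chunk:
  assumes "0 < w" "k \<le> length xs" "odd ((k - 1) div w)"
  shows "(k - 1) div w - 1 < length (chunks w xs)"
    and "dyadic_part w k xs = chunks w xs ! ((k - 1) div w - 1)"
proof -
  define q where "q = (k - 1) div w"
  have "0 < q" using assms(3) unfolding q_def by (metis even_zero gr0I)
  moreover have "q * w \<le> k - 1" unfolding q_def by simp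
  ultimately have "q * w \<le> length xs + (w - 1)" using assms(2) by linarith
  then have "q \<le> (length xs + (w - 1)) div w"
    using assms(1) by (simp add: less_eq_div_iff_mult_less_eq)
  then show lt: "(k - 1) div w - 1 < length (chunks w xs)"
    using assms(1) \<open>0 < q\<close> by (simp add: length_chunks q_def)
  show "dyadic_part w k xs = chunks w xs ! ((k - 1) div w - 1)"
    using assms(3) nth_chunks[OF lt] by (simp add: dyadic_part_def Let_def)
qed

text \<open>Write \<open>m = k - 1\<close>.  Clearing the lowest \<open>L\<close> binary digits of \<open>m\<close> leaves
  \<open>2\<^sup>L (m div 2\<^sup>L)\<close>.  Clearing one more digit changes this number only if the digit is \<open>1\<close>, and then
  it removes from the prefix exactly the block of length \<open>2\<^sup>L\<close> at its end.  So the prefix of length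
  \<open>m\<close> is the prefix with cleared digits together with the blocks removed so far, and for
  \<open>m < 2\<^sup>L\<close> nothing else remains.\<close>

lemma length_filter_dyadic_parts:
  assumes "k - 1 < 2 ^ L"
  shows "(\<Sum>j<L. length (filter P (dyadic_part (2 ^ j) k xs))) = length (filter P (take (k - 1) xs))"
proof -
  let ?cnt = "\<lambda>ys. length (filter P ys)"
  define m where "m = k - 1"
  \<comment> \<open>generalised from \<open>m < 2\<^sup>L\<close> to all \<open>L\<close>, keeping the part not yet cut off\<close>
  have "?cnt (take (2 ^ L * (m div 2 ^ L)) xs) + (\<Sum>j<L. ?cnt (dyadic_part (2 ^ j) k xs)) =
        ?cnt (take m xs)" for L
  proof (induction L)
    case (Suc L)
    define q where "q = m div 2 ^ L"
    have q2: "m div 2 ^ Suc L = q div 2"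
      by (simp add: q_def div_mult2_eq mult.commute[of 2])
    have "?cnt (take (2 ^ Suc L * (q div 2)) xs) + ?cnt (dyadic_part (2 ^ L) k xs) =
          ?cnt (take (2 ^ L * q) xs)"
    proof (cases "odd q")
      case True
      then have before: "2 ^ Suc L * (q div 2) = 2 ^ L * (q - 1)"
        by (auto elim: oddE)
      have after: "2 ^ L * q = 2 ^ L * (q - 1) + 2 ^ L"
        using True by (cases q) auto
      have part: "dyadic_part (2 ^ L) k xs = take (2 ^ L) (drop (2 ^ L * (q - 1)) xs)"
        using True by (simp add: dyadic_part_def q_def m_def)
      show ?thesis
        unfolding before part by (simp only: after take_add filter_append length_append)
    next
      case False
      then have before: "2 ^ Suc L * (q div 2) = 2 ^ L * q" by auto
      have part: "dyadic_part (2 ^ L) k xs = []"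
        using False by (simp add: dyadic_part_def q_def m_def)
      show ?thesis unfolding before part by simp
    qed
    then show ?case using Suc.IH q2 by (simp add: q_def)
  qed simp
  from this[of L] show ?thesis using assms by (simp add: m_def)
qed

lemma even_block_val_time:
  "val (even_block w k) =
     (if odd ((k - 1) div w) then Some ((k - 1) div w + 1) else None)"
  "time (even_block w k) \<le> 6"
  by (auto simp: even_block_def odd_iff_mod_2_eq_one mod_Suc)

section \<open>Dominance counts\<close>

definition dominated :: "vect list \<Rightarrow> vect \<Rightarrow> nat" where
  "dominated as b = length (filter (\<lambda>u. list_all2 (\<le>) u b) as)"

text \<open>The index \<open>k\<^sub>i\<close> of a query, as a count: in a sorted family the two agree, and the count is
  \<open>0\<close> when no index qualifies.\<close>

definition first_rank :: "vect list \<Rightarrow> vect \<Rightarrow> nat" where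
  "first_rank a b = length (filter (\<lambda>u. hd u \<le> hd b) a)"

definition initial_count :: "vect list \<Rightarrow> vect \<Rightarrow> nat" where
  "initial_count a b = (if first_rank a b = 0 then 0
     else of_bool (list_all2 (\<le>) (a ! (first_rank a b - 1)) b))"

text \<open>What the level of block length \<open>w\<close> contributes to a query.\<close>

definition level_count :: "vect list \<Rightarrow> vect \<Rightarrow> nat \<Rightarrow> nat" where
  "level_count a b w = dominated (map tl (dyadic_part w (first_rank a b) a)) (tl b)"

lemma dominated_mset_cong: "mset as = mset as' \<Longrightarrow> dominated as b = dominated as' b"
  unfolding dominated_def by (metis mset_filter size_mset)

lemma first_rank_le_length: "first_rank a b \<le> length a"
  by (simp add: first_rank_def)

lemma level_count_eq_0:
  "even ((first_rank a v - 1) div w) \<Longrightarrow> level_count a v w = 0"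
  by (simp add: level_count_def dyadic_part_def dominated_def)

text \<open>The block that a query needs is one of the blocks built at this level, with the index that
  the algorithms read (\<open>\<ell> - 1 = q\<close>, stored at list position \<open>q - 1\<close>).\<close>

lemma level_count_chunk:
  assumes "0 < w" "odd ((first_rank a v - 1) div w)"
  shows "(first_rank a v - 1) div w - 1 < length (chunks w a)"
    and "level_count a v w =
      dominated (chunks w (map tl a) ! ((first_rank a v - 1) div w - 1)) (tl v)"
  using dyadic_part_eq_chunk[OF assms(1) first_rank_le_length assms(2)]
  by (simp_all add: level_count_def flip: map_chunks)

lemma filter_sorted_eq_take:
  assumes "sorted (map f xs)"
  shows "filter (\<lambda>x. f x \<le> y) xs = take (length (filter (\<lambda>x. f x \<le> y) xs)) xs"
  using assms
proof (induction xs)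
  case (Cons x xs)
  have "filter (\<lambda>x. f x \<le> y) xs = []" if "\<not> f x \<le> y"
    using Cons.prems that by (force simp: filter_empty_conv)
  with Cons show ?case by auto
qed simp

text \<open>The vectors with first coordinate at most that of \<open>b\<close> are the first \<open>k\<close> ones, so dominance
  by \<open>b\<close> is counted by comparing tails on this prefix.  Its last entry is the initial count, the rest
  is the union of the dyadic blocks.\<close>

lemma dominated_eq_initial_plus_levels:
  assumes sorted: "sorted (map hd a)"
    and dims: "\<forall>u \<in> set a. length u = Suc d" "length b = Suc d"
  shows "dominated a b =
    initial_count a b + (\<Sum>j<clog (length a). level_count a b (2 ^ j))"
proof -
  define k where "k = first_rank a b"
  let ?P = "\<lambda>u. list_all2 (\<le>) u b"
  let ?Q = "\<lambda>u. list_all2 (\<le>) (tl u) (tl b)"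
  have split: "?P u \<longleftrightarrow> hd u \<le> hd b \<and> ?Q u" if "u \<in> set a" for u
    using dims(2) bspec[OF dims(1) that] by (auto simp: length_Suc_conv)
  have prefix: "filter (\<lambda>u. hd u \<le> hd b) a = take k a"
    unfolding k_def first_rank_def by (rule filter_sorted_eq_take[OF sorted])
  have k_le: "k \<le> length a" unfolding k_def by (rule first_rank_le_length)
  have "filter ?P a = filter ?Q (filter (\<lambda>u. hd u \<le> hd b) a)"
    by (auto intro!: filter_cong simp: split)
  then have count: "dominated a b = length (filter ?Q (take k a))"
    by (simp add: dominated_def prefix)
  have levels: "(\<Sum>j<clog (length a). level_count a b (2 ^ j)) = length (filter ?Q (take (k - 1) a))"
  proof -
    have "level_count a b w = length (filter ?Q (dyadic_part w k a))" for w
      by (simp add: level_count_def dominated_def k_def filter_map o_def)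
    moreover have "k - 1 < 2 ^ clog (length a)"
    proof (cases "k = 0")
      case False
      then show ?thesis using k_le le_two_power_clog[of "length a"] by linarith
    qed simp
    ultimately show ?thesis by (simp add: length_filter_dyadic_parts)
  qed
  show ?thesis
  proof (cases k)
    case 0
    then show ?thesis using count levels by (simp add: initial_count_def k_def)
  next
    case (Suc m)
    then have m: "m < length a" using k_le by simp
    have "a ! m \<in> set (take k a)" using Suc m by (auto simp: in_set_conv_nth)
    then have "hd (a ! m) \<le> hd b" by (simp add: prefix[symmetric])
    then have "?P (a ! m) = ?Q (a ! m)" using split m by simp
    then show ?thesis using count levels Suc m
      by (simp add: initial_count_def k_def take_Suc_conv_app_nth)
  qed
qed

section \<open>The two common first steps\<close>

lemma sort_first_val_time:
  "mset (elems (val (sort_first as))) = mset as"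
  "sorted (map hd (elems (val (sort_first as))))"
  "time (sort_first as) \<le> 8 * length as * clog (length as) + 3 * length as + 3"
proof -
  let ?as = "val (merge_sort first_leq (length as) as)"
  have sorted: "mset ?as = mset as \<and> sorted (map hd ?as)"
    by (rule merge_sort_val) simp_all
  show "mset (elems (val (sort_first as))) = mset as"
    "sorted (map hd (elems (val (sort_first as))))"
    using sorted by (simp_all add: sort_first_def list_size_val_time)
  have "length (val (merge_sort first_leq (length as) as)) = length as"
    using sorted by (blast intro: mset_eq_length)
  then show "time (sort_first as) \<le> 8 * length as * clog (length as) + 3 * length as + 3"
    using time_merge_sort[of first_leq 3 hd "length as" as]
    by (simp add: sort_first_def list_size_val_time)
qed

text \<open>The loop bodies of the algorithms are named so that facts about one iteration can be stated;
  the equations named \<open>_unfold\<close> put them back.\<close>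

definition locate_step ::
  "vect array \<Rightarrow> vect array \<Rightarrow> nat \<Rightarrow> nat \<Rightarrow> nat array \<times> nat array \<Rightarrow> (nat array \<times> nat array) timed" where
  "locate_step a b na = (\<lambda>i (k, c). do {
       bi \<leftarrow> aget b i;
       ki \<leftarrow> bin_search (\<lambda>i'. do { x \<leftarrow> aget a i'; first_leq x bi }) 0 na;
       k \<leftarrow> aset k i ki;
       none \<leftarrow> eq ki 0;
       if none then return (k, c)
       else do {
         ak \<leftarrow> aget a ki;
         dominated \<leftarrow> vec_leq ak bi;
         c \<leftarrow> aset c i (if dominated then 1 else 0);
         return (k, c)
       }
     })"

lemma locate_unfold:
  "locate a b = do {
     na \<leftarrow> asize a;
     nb \<leftarrow> asize b;
     k \<leftarrow> new_array nb 0;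
     c \<leftarrow> new_array nb 0;
     for_loop 1 nb (locate_step a b na) (k, c)
   }"
  unfolding locate_def locate_step_def by (rule refl)

lemma first_rank_search:
  assumes "sorted (map hd (elems a))"
  shows "val (bin_search (\<lambda>i'. do { x \<leftarrow> aget a i'; first_leq x v }) 0 (length (elems a))) =
    first_rank (elems a) v"
proof (rule bin_search_val)
  fix i assume "0 < i" "i \<le> length (elems a)"
  then show "val (do { x \<leftarrow> aget a i; first_leq x v }) = (i \<le> first_rank (elems a) v)"
    using sorted_nth_le_iff[OF assms, of "i - 1" "hd v"] by (auto simp: first_rank_def)
qed (auto simp: first_rank_le_length)

lemma locate_val_time:
  assumes sorted: "sorted (map hd (elems a))" and dims: "\<forall>u \<in> set (elems a). length u \<le> d"
  shows "val (locate a b) =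
      (Array (map (first_rank (elems a)) (elems b)), Array (map (initial_count (elems a)) (elems b)))"
    and "time (locate a b) \<le>
      length (elems b) * (9 * (clog (length (elems a)) + 1) + d + 11) + 5"
proof -
  let ?A = "elems a" and ?B = "elems b"
  let ?na = "length ?A" and ?nb = "length ?B"
  define C where "C = 9 * (clog ?na + 1) + d + 7"
  define I :: "nat \<Rightarrow> nat array \<times> nat array \<Rightarrow> bool" where
    "I t = (\<lambda>(k, c). length (elems k) = ?nb \<and> length (elems c) = ?nb \<and>
      (\<forall>i<t - 1. elems k ! i = first_rank ?A (?B ! i)) \<and>
      (\<forall>i<?nb. elems c ! i = (if i < t - 1 then initial_count ?A (?B ! i) else 0)))" for t
  have loop: "I (Suc ?nb) (val (for_loop 1 ?nb (locate_step a b ?na)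
         (Array (replicate ?nb 0), Array (replicate ?nb 0)))) \<and>
       time (for_loop 1 ?nb (locate_step a b ?na)
         (Array (replicate ?nb 0), Array (replicate ?nb 0))) \<le> 1 + (\<Sum>i=1..?nb. C + 2)"
  proof (rule for_loop_invariant)
    show "I 1 (Array (replicate ?nb 0), Array (replicate ?nb 0))" by (simp add: I_def)
    fix i :: nat and s :: "nat array \<times> nat array"
    assume i: "1 \<le> i" "i \<le> ?nb" and inv: "I i s"
    obtain k c where s: "s = (k, c)" by (cases s)
    let ?v = "?B ! (i - 1)"
    let ?r = "first_rank ?A ?v"
    note [simp] = first_rank_search[OF sorted]
    have search: "time (bin_search (\<lambda>i'. do { x \<leftarrow> aget a i'; first_leq x ?v }) 0 ?na) \<le>
        9 * (clog ?na + 1) + 1"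
      using time_bin_search[of "\<lambda>i'. do { x \<leftarrow> aget a i'; first_leq x ?v }" 4 0 ?na] by simp
    have "time (vec_leq (?A ! (?r - 1)) ?v) \<le> d + 1" if "?r \<noteq> 0"
    proof -
      have "?r - 1 < ?na" using that first_rank_le_length[of ?A ?v] by linarith
      then have "length (?A ! (?r - 1)) \<le> d" using dims by simp
      then show ?thesis using vec_leq_val_time(2)[of "?A ! (?r - 1)" ?v] by linarith
    qed
    then have "time (locate_step a b ?na i s) \<le> C"
      using search by (auto simp: locate_step_def s C_def)
    moreover have "val (locate_step a b ?na i s) =
        (Array ((elems k)[i - 1 := ?r]),
         Array ((elems c)[i - 1 := initial_count ?A ?v]))"
    proof (cases "?r = 0")
      case True
      have "elems c ! (i - 1) = 0" using inv i by (auto simp: I_def s)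
      then have "(elems c)[i - 1 := 0] = elems c" by (metis list_update_id)
      then show ?thesis using True by (simp add: locate_step_def s initial_count_def)
    next
      case False
      then show ?thesis
        by (simp add: locate_step_def s initial_count_def vec_leq_val_time(1))
    qed
    ultimately show "I (Suc i) (val (locate_step a b ?na i s)) \<and>
        time (locate_step a b ?na i s) \<le> C"
      using inv i by (auto simp: I_def s nth_list_update less_Suc_eq)
  qed simp
  show "val (locate a b) =
      (Array (map (first_rank ?A) ?B), Array (map (initial_count ?A) ?B))"
    using loop
    by (auto simp: locate_unfold I_def case_prod_beta prod_eq_iff intro!: array.expand nth_equalityI)
  show "time (locate a b) \<le> ?nb * (9 * (clog ?na + 1) + d + 11) + 5"
    using loop by (simp add: locate_unfold C_def algebra_simps)
qed

section \<open>Shared accounting of the loop over the levels\<close>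

text \<open>The bound is linear in \<open>n\<^sub>a + n\<^sub>b\<close> and not stated with the maximum, because it is summed over
  the blocks of a level, where sums of sizes are preserved.  The logarithm is that of \<open>n\<^sub>a\<close> alone:
  the searches and the levels all range over \<open>a\<close>.  The summand \<open>1\<close> keeps the bound positive on empty
  input.\<close>

definition ranks_within ::
  "nat \<Rightarrow> nat \<Rightarrow> (vect list \<Rightarrow> vect list \<Rightarrow> nat list timed) \<Rightarrow> bool" where
  "ranks_within d K alg \<longleftrightarrow>
     (\<forall>as bs. (\<forall>v \<in> set as \<union> set bs. length v = d) \<longrightarrow>
        val (alg as bs) = map (dominated as) bs \<and>
        time (alg as bs) \<le> K * (length as + length bs + 1) * (clog (length as) + 1) ^ d)"

lemma ranks_withinD:
  assumes "ranks_within d K alg" "\<forall>v \<in> set as \<union> set bs. length v = d"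
  shows "val (alg as bs) = map (dominated as) bs"
    and "time (alg as bs) \<le> K * (length as + length bs + 1) * (clog (length as) + 1) ^ d"
  using assms unfolding ranks_within_def by blast+

text \<open>The value of the counter of a query after \<open>m\<close> levels.\<close>

definition count_upto :: "vect list \<Rightarrow> nat \<Rightarrow> vect \<Rightarrow> nat" where
  "count_upto a m b = initial_count a b + (\<Sum>j<m. level_count a b (2 ^ j))"

lemma count_upto_simps [simp]:
  "count_upto a 0 b = initial_count a b"
  "count_upto a (Suc m) b = count_upto a m b + level_count a b (2 ^ m)"
  by (simp_all add: count_upto_def)

lemma sort_and_locate_cost_le:
  fixes na nb c d :: nat
  shows "(8 * na * c + 3 * na + 3) + (nb + 1) + 2 + (nb * (9 * (c + 1) + d + 11) + 5) + (4 * c + 1)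
    \<le> (d + 40) * (na + nb + 1) * (c + 1)"
  by (simp add: algebra_simps)

text \<open>The part common to both algorithms: what the first two steps leave behind and cost, and why
  the counters are correct once all levels have been added.\<close>

lemma sort_and_locate:
  assumes dims: "\<forall>v \<in> set as \<union> set bs. length v = Suc d"
  obtains a where "val (sort_first as) = Array a" "length a = length as" "set a = set as"
    "val (locate (Array a) (Array bs)) =
       (Array (map (first_rank a) bs), Array (map (count_upto a 0) bs))"
    "time (sort_first as) + (length bs + 1) + 2 + time (locate (Array a) (Array bs)) +
       time (ceil_log2 (length as)) \<le>
     (Suc d + 40) * (length as + length bs + 1) * (clog (length as) + 1)"
    "map (count_upto a (clog (length as))) bs = map (dominated as) bs"
proof
  define a where "a = elems (val (sort_first as))"
  have mset: "mset a = mset as" and sorted: "sorted (map hd a)"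
    using sort_first_val_time by (simp_all add: a_def)
  show "val (sort_first as) = Array a" by (simp add: a_def)
  show len: "length a = length as" and set: "set a = set as"
    using mset by (metis size_mset, metis set_mset_mset)
  note loc = locate_val_time[of "Array a" "Suc d" "Array bs", simplified]
  show "val (locate (Array a) (Array bs)) =
      (Array (map (first_rank a) bs), Array (map (count_upto a 0) bs))"
    using loc(1) sorted dims by (simp add: set)
  have "time (locate (Array a) (Array bs)) \<le>
      length bs * (9 * (clog (length as) + 1) + Suc d + 11) + 5"
    using loc(2) sorted dims by (simp add: set len)
  then show "time (sort_first as) + (length bs + 1) + 2 + time (locate (Array a) (Array bs)) +
       time (ceil_log2 (length as)) \<le>
     (Suc d + 40) * (length as + length bs + 1) * (clog (length as) + 1)"
    using sort_and_locate_cost_le[of "length as" "clog (length as)" "length bs" "Suc d"]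
      sort_first_val_time(3)[of as] time_ceil_log2[of "length as"]
    by linarith
  show "map (count_upto a (clog (length as))) bs = map (dominated as) bs"
  proof (rule map_cong[OF refl])
    fix v assume "v \<in> set bs"
    then have "dominated a v = count_upto a (clog (length as)) v"
      using dominated_eq_initial_plus_levels[OF sorted, of d v] dims
      by (simp add: set len count_upto_def)
    then show "count_upto a (clog (length as)) v = dominated as v"
      using dominated_mset_cong[OF mset] by simp
  qed
qed

text \<open>The common bookkeeping of the exponents: fewer than \<open>L\<close> levels of cost \<open>R N L\<^sup>e\<close> give the
  exponent \<open>Suc e\<close>, which also absorbs the remaining costs, of order \<open>N L\<close>.\<close>

lemma total_cost_le:
  fixes na nb c S R e :: nat
  defines "N \<equiv> na + nb + 1" and "L \<equiv> c + 1"
  shows "S * N * L + (1 + c * (R * N * L ^ e + 2)) + (nb + 1) \<le> (S + R + 4) * N * L ^ Suc e"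
proof -
  define M where "M = N * L ^ Suc e"
  have L: "1 \<le> L" "1 \<le> L ^ e" by (simp_all add: L_def)
  have NL: "N * L \<le> M" unfolding M_def using L by simp
  have "S * N * L \<le> S * M" using mult_le_mono2[OF NL, of S] by (simp add: mult.assoc)
  moreover have "c * (R * N * L ^ e) \<le> R * M"
  proof -
    have "c * (R * N * L ^ e) \<le> L * (R * N * L ^ e)" by (simp add: L_def)
    then show ?thesis by (simp add: M_def algebra_simps)
  qed
  moreover have "c + nb + 1 \<le> M" "c + 1 \<le> M"
    using NL by (simp_all add: N_def L_def algebra_simps)
  ultimately have "S * N * L + (1 + c * (R * N * L ^ e + 2)) + (nb + 1) \<le> (S + R + 4) * M"
    unfolding add_mult_distrib add_mult_distrib2 by linarith
  then show ?thesis by (simp only: M_def mult.assoc)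
qed

text \<open>A loop that updates only the current counter adds \<open>f\<close> to all of them.  The counters are
  indexed from \<open>1\<close> in the loop and from \<open>0\<close> in the list.\<close>

lemma for_loop_accumulate:
  fixes f g :: "'a \<Rightarrow> nat"
  assumes "\<And>i c. 1 \<le> i \<Longrightarrow> i \<le> length bs \<Longrightarrow> length (elems c) = length bs \<Longrightarrow>
      val (body i c) = Array ((elems c)[i - 1 := elems c ! (i - 1) + f (bs ! (i - 1))]) \<and>
      time (body i c) \<le> C"
  shows "val (for_loop 1 (length bs) body (Array (map g bs))) = Array (map (\<lambda>v. g v + f v) bs)"
    and "time (for_loop 1 (length bs) body (Array (map g bs))) \<le> 1 + length bs * (C + 2)"
proof -
  define I where "I t c \<longleftrightarrow> length (elems c) = length bs \<and>
    (\<forall>i<length bs. elems c ! i = g (bs ! i) + (if i < t - 1 then f (bs ! i) else 0))" for t c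
  have "I (Suc (length bs)) (val (for_loop 1 (length bs) body (Array (map g bs)))) \<and>
    time (for_loop 1 (length bs) body (Array (map g bs))) \<le> 1 + (\<Sum>i=1..length bs. C + 2)"
  proof (rule for_loop_invariant)
    show "I 1 (Array (map g bs))" by (simp add: I_def)
    fix i c assume i: "1 \<le> i" "i \<le> length bs" and inv: "I i c"
    then show "I (Suc i) (val (body i c)) \<and> time (body i c) \<le> C"
      using assms[OF i, of c] by (auto simp: I_def nth_list_update)
  qed simp
  then show "val (for_loop 1 (length bs) body (Array (map g bs))) = Array (map (\<lambda>v. g v + f v) bs)"
    and "time (for_loop 1 (length bs) body (Array (map g bs))) \<le> 1 + length bs * (C + 2)"
    by (auto simp: I_def intro!: array.expand nth_equalityI)
qed

section \<open>Algorithm A\<close>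

definition scan_step ::
  "real array array \<Rightarrow> vect array \<Rightarrow> nat array \<Rightarrow> nat \<Rightarrow> nat \<Rightarrow> nat array \<Rightarrow> nat array timed" where
  "scan_step e b k w = (\<lambda>i c. do {
         ki \<leftarrow> aget k i;
         block \<leftarrow> even_block w ki;
         case block of
           None \<Rightarrow> return c
         | Some l \<Rightarrow> do {
             l' \<leftarrow> sub l 1;
             el \<leftarrow> aget e l';
             bi \<leftarrow> aget b i;
             y \<leftarrow> second bi;
             r \<leftarrow> rank_in el y;
             ci \<leftarrow> aget c i;
             ci' \<leftarrow> add ci r;
             aset c i ci'
           }
       })"

definition level_A ::
  "vect array \<Rightarrow> vect array \<Rightarrow> nat \<Rightarrow> nat \<Rightarrow> nat array \<Rightarrow> nat \<Rightarrow>
   nat \<times> real list list \<times> nat array \<Rightarrow> (nat \<times> real list list \<times> nat array) timed" where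
  "level_A a b na nb k = (\<lambda>j (w, es, c). do {
       start \<leftarrow> eq j 1;
       es \<leftarrow> (if start
              then tabulate 1 na (\<lambda>i. do { ai \<leftarrow> aget a i; x \<leftarrow> second ai; return [x] })
              else merge_adjacent leq es);
       arrays \<leftarrow> map_list array_of es;
       e \<leftarrow> array_of arrays;
       c \<leftarrow> for_loop 1 nb (scan_step e b k w) c;
       w \<leftarrow> add w w;
       return (w, es, c)
     })"

lemma algorithm_A_unfold:
  "algorithm_A as bs = do {
     a \<leftarrow> sort_first as;
     b \<leftarrow> array_of bs;
     na \<leftarrow> asize a;
     nb \<leftarrow> asize b;
     (k, c) \<leftarrow> locate a b;
     levels \<leftarrow> ceil_log2 na;
     (_, _, c) \<leftarrow> for_loop 1 levels (level_A a b na nb k) (1, [], c);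
     list_of c
   }"
  unfolding algorithm_A_def level_A_def scan_step_def by (rule refl)

lemma length_filter_sort: "length (filter P (sort xs)) = length (filter P xs)"
  by (metis mset_filter mset_sort size_mset)

lemma dominated_singletons:
  assumes "\<forall>u \<in> set us. length u = 1" "length v = 1"
  shows "dominated us v = length (filter (\<lambda>x. x \<le> hd v) (map hd us))"
proof -
  have "list_all2 (\<le>) u v \<longleftrightarrow> hd u \<le> hd v" if "u \<in> set us" for u
    using bspec[OF assms(1) that] assms(2) by (auto simp: length_Suc_conv)
  then show ?thesis
    by (simp add: dominated_def filter_map o_def cong: filter_cong)
qed

text \<open>In dimension two the tails are single numbers, so the contribution of a block is the rank of
  the second coordinate among those of the block, found by one binary search.\<close>

lemma scan_step_val_time:
  assumes dims: "\<forall>u \<in> set a. length u = 2" "\<forall>v \<in> set bs. length v = 2"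
    and w: "0 < w" and i: "1 \<le> i" "i \<le> length bs" and c: "length (elems c) = length bs"
    and e: "e = Array (map (\<lambda>xs. Array (sort xs)) (chunks w (map (\<lambda>u. hd (tl u)) a)))"
    and k: "k = Array (map (first_rank a) bs)"
  shows "val (scan_step e (Array bs) k w i c) =
      Array ((elems c)[i - 1 := elems c ! (i - 1) + level_count a (bs ! (i - 1)) w]) \<and>
    time (scan_step e (Array bs) k w i c) \<le> 7 * (clog (length a) + 1) + 17"
proof -
  let ?v = "bs ! (i - 1)"
  define q where "q = (first_rank a ?v - 1) div w"
  have block: "val (even_block w (first_rank a ?v)) = (if odd q then Some (q + 1) else None)"
    and ki: "elems k ! (i - 1) = first_rank a ?v"
    using i by (simp_all add: even_block_val_time(1) q_def k)
  note t6 = even_block_val_time(2)[of w "first_rank a ?v"]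
  show ?thesis
  proof (cases "odd q")
    case False
    then have "level_count a ?v w = 0" by (simp add: level_count_eq_0 q_def)
    then show ?thesis using False t6 block ki
      by (simp add: scan_step_def split: option.split)
  next
    case True
    define xs where "xs = chunks w a ! (q - 1)"
    let ?M = "Array (sort (map (\<lambda>u. hd (tl u)) xs))"
    have q: "q - 1 < length (chunks w a)"
      and count: "level_count a ?v w = dominated (chunks w (map tl a) ! (q - 1)) (tl ?v)"
      using level_count_chunk[OF w] True by (auto simp: q_def)
    have xs: "set xs \<subseteq> set a" unfolding xs_def using q set_chunks by (metis nth_mem)
    have v: "length ?v = 2" using dims(2) i by simp
    have "elems e ! (q - 1) = ?M"
      using q by (simp add: e xs_def flip: map_chunks)
    moreover have "val (rank_in ?M (hd (tl ?v))) = level_count a ?v w"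
    proof -
      have "chunks w (map tl a) ! (q - 1) = map tl xs"
        using q by (simp add: xs_def flip: map_chunks)
      moreover have "dominated (map tl xs) (tl ?v) =
          length (filter (\<lambda>x. x \<le> hd (tl ?v)) (map hd (map tl xs)))"
        by (rule dominated_singletons) (use xs dims(1) v in auto)
      ultimately have "level_count a ?v w =
          length (filter (\<lambda>x. x \<le> hd (tl ?v)) (map hd (map tl xs)))"
        using count by simp
      then show ?thesis
        by (simp add: rank_in_val_time(1) length_filter_sort o_def)
    qed
    moreover have "time (rank_in ?M (hd (tl ?v))) \<le> 7 * (clog (length a) + 1) + 2"
    proof -
      have "length xs \<le> length a" using q by (simp add: xs_def nth_chunks)
      then have "clog (length xs) \<le> clog (length a)" by (rule clog_mono)
      then show ?thesis using rank_in_val_time(2)[of ?M "hd (tl ?v)"] by simp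
    qed
    ultimately show ?thesis using True t6 block ki by (simp add: scan_step_def)
  qed
qed

text \<open>Level \<open>j = Suc m\<close> has block length \<open>2\<^sup>m\<close>.  Its sorted blocks are made from single entries for
  \<open>m = 0\<close> and otherwise from the blocks of length \<open>2\<^sup>m\<^sup>-\<^sup>1\<close> left by the previous level.\<close>

lemma level_A_val_time:
  assumes dims: "\<forall>u \<in> set a. length u = 2" "\<forall>v \<in> set bs. length v = 2"
    and k: "k = Array (map (first_rank a) bs)"
    and es: "0 < m \<Longrightarrow> es = map sort (chunks (2 ^ (m - 1)) (map (\<lambda>u. hd (tl u)) a))"
  shows "val (level_A (Array a) (Array bs) (length a) (length bs) k (Suc m)
        (2 ^ m, es, Array (map (count_upto a m) bs))) =
      (2 ^ Suc m, map sort (chunks (2 ^ m) (map (\<lambda>u. hd (tl u)) a)),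
       Array (map (count_upto a (Suc m)) bs))"
    and "time (level_A (Array a) (Array bs) (length a) (length bs) k (Suc m)
        (2 ^ m, es, Array (map (count_upto a m) bs))) \<le>
      30 * (length a + length bs + 1) * (clog (length a) + 1)"
proof -
  let ?xs = "map (\<lambda>u. hd (tl u)) a" and ?w = "2 ^ m :: nat"
  let ?es = "map sort (chunks ?w ?xs)"
  let ?e = "Array (map (\<lambda>xs. Array (sort xs)) (chunks ?w ?xs))"
  define blocks where "blocks = (if Suc m = 1
     then tabulate 1 (length a) (\<lambda>i. do { ai \<leftarrow> aget (Array a) i; x \<leftarrow> second ai; return [x] })
     else merge_adjacent leq es)"
  have blocks: "val blocks = ?es" "time blocks \<le> 5 * length a + 1"
  proof -
    have "val blocks = ?es \<and> time blocks \<le> 5 * length a + 1"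
    proof (cases m)
      case 0
      have "map (\<lambda>i. [hd (tl (a ! (i - 1)))]) [1..<Suc (length a)] = map (\<lambda>x. [x]) ?xs"
        by (rule nth_equalityI) (simp_all del: upt_Suc)
      then show ?thesis
        using 0 by (simp add: blocks_def tabulate_val_time chunks_1 o_def del: upt_Suc)
    next
      case (Suc p)
      then have es: "es = map sort (chunks (2 ^ p) ?xs)" using es by simp
      have "(\<Sum>xs\<leftarrow>es. length xs) = length a" "length es \<le> length a"
        using sum_length_chunks[of "2 ^ p" ?xs] length_chunks_le[of "2 ^ p" ?xs]
        by (simp_all add: es o_def)
      then show ?thesis
        using Suc time_merge_adjacent[of es] merge_adjacent_chunks[of "2 ^ p" ?xs]
        by (simp add: blocks_def es)
    qed
    then show "val blocks = ?es" "time blocks \<le> 5 * length a + 1" by blast+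
  qed
  have arrays: "val (map_list array_of ?es) = map (\<lambda>xs. Array (sort xs)) (chunks ?w ?xs)"
    "time (map_list array_of ?es) \<le> 3 * length a + 1"
  proof -
    have "time (map_list array_of ?es) = 1 + (length a + 2 * length (chunks ?w ?xs))"
      using sum_length_chunks[of ?w ?xs]
      by (simp add: map_list_val_time o_def sum_list_Suc)
    then show "time (map_list array_of ?es) \<le> 3 * length a + 1"
      using length_chunks_le[of ?w ?xs] by simp
  qed (simp add: map_list_val_time o_def)
  have step: "val (scan_step ?e (Array bs) k ?w i c) =
      Array ((elems c)[i - 1 := elems c ! (i - 1) + level_count a (bs ! (i - 1)) ?w]) \<and>
      time (scan_step ?e (Array bs) k ?w i c) \<le> 7 * (clog (length a) + 1) + 17"
    if "1 \<le> i" "i \<le> length bs" "length (elems c) = length bs" for i c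
    by (rule scan_step_val_time[OF dims _ that refl k]) simp
  have scan:
    "val (for_loop 1 (length bs) (scan_step ?e (Array bs) k ?w) (Array (map (count_upto a m) bs))) =
       Array (map (\<lambda>v. count_upto a m v + level_count a v ?w) bs)"
    "time (for_loop 1 (length bs) (scan_step ?e (Array bs) k ?w) (Array (map (count_upto a m) bs)))
       \<le> 1 + length bs * (7 * (clog (length a) + 1) + 17 + 2)"
    by (rule for_loop_accumulate, rule step, assumption+)+
  have unfold: "level_A (Array a) (Array bs) (length a) (length bs) k (Suc m)
      (?w, es, Array (map (count_upto a m) bs)) = do {
       eq (Suc m) 1;
       es \<leftarrow> blocks;
       arrays \<leftarrow> map_list array_of es;
       e \<leftarrow> array_of arrays;
       c \<leftarrow> for_loop 1 (length bs) (scan_step e (Array bs) k ?w) (Array (map (count_upto a m) bs));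
       w \<leftarrow> add ?w ?w;
       return (w, es, c) }"
    by (simp add: level_A_def blocks_def bind_timed_def)
  show "val (level_A (Array a) (Array bs) (length a) (length bs) k (Suc m)
        (2 ^ m, es, Array (map (count_upto a m) bs))) =
      (2 ^ Suc m, ?es, Array (map (count_upto a (Suc m)) bs))"
    unfolding unfold using scan(1) by (simp add: blocks arrays)
  have "time (level_A (Array a) (Array bs) (length a) (length bs) k (Suc m)
        (2 ^ m, es, Array (map (count_upto a m) bs))) \<le>
      9 * length a + length bs * (7 * (clog (length a) + 1) + 19) + 6"
    unfolding unfold using scan(2) blocks arrays length_chunks_le[of ?w ?xs] by simp
  also have "\<dots> \<le> 30 * (length a + length bs + 1) * (clog (length a) + 1)"
    by (simp add: algebra_simps)
  finally show "time (level_A (Array a) (Array bs) (length a) (length bs) k (Suc m)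
        (2 ^ m, es, Array (map (count_upto a m) bs))) \<le>
      30 * (length a + length bs + 1) * (clog (length a) + 1)" .
qed

text \<open>The constant is \<open>42 + 30 + 4\<close>: the first two steps, one level, and the overhead in
  \<open>total_cost_le\<close>.\<close>

lemma algorithm_A_ranks_within: "ranks_within 2 76 algorithm_A"
  unfolding ranks_within_def
proof (intro allI impI)
  fix as bs :: "vect list"
  assume dims: "\<forall>v \<in> set as \<union> set bs. length v = 2"
  let ?na = "length as" and ?nb = "length bs" and ?c = "clog (length as)"
  obtain a where sortA: "val (sort_first as) = Array a"
    and len: "length a = ?na" and set: "set a = set as"
    and locv: "val (locate (Array a) (Array bs)) =
      (Array (map (first_rank a) bs), Array (map (count_upto a 0) bs))"
    and prelude: "time (sort_first as) + (?nb + 1) + 2 + time (locate (Array a) (Array bs)) +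
      time (ceil_log2 ?na) \<le> (Suc 1 + 40) * (?na + ?nb + 1) * (?c + 1)"
    and result: "map (count_upto a ?c) bs = map (dominated as) bs"
    by (rule sort_and_locate[of as bs 1]) (use dims in auto)
  define k where "k = Array (map (first_rank a) bs)"
  note locv = locv[folded k_def]
  let ?loop = "for_loop 1 ?c (level_A (Array a) (Array bs) ?na ?nb k)
     (1, [], Array (map (count_upto a 0) bs))"
  define I where "I t s \<longleftrightarrow> fst s = 2 ^ (t - 1) \<and>
     (1 < t \<longrightarrow> fst (snd s) = map sort (chunks (2 ^ (t - 2)) (map (\<lambda>u. hd (tl u)) a))) \<and>
     snd (snd s) = Array (map (count_upto a (t - 1)) bs)"
     for t and s :: "nat \<times> real list list \<times> nat array"
  have loop: "I (Suc ?c) (val ?loop) \<and>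
     time ?loop \<le> 1 + (\<Sum>j=1..?c. 30 * (?na + ?nb + 1) * (?c + 1) ^ 1 + 2)"
  proof (rule for_loop_invariant)
    show "I 1 (1, [], Array (map (count_upto a 0) bs))" by (simp add: I_def)
    fix j s assume j: "1 \<le> j" and inv: "I j s"
    obtain m where m: "j = Suc m" using j by (cases j) auto
    obtain es where s: "s = (2 ^ m, es, Array (map (count_upto a m) bs))"
      and es: "0 < m \<Longrightarrow> es = map sort (chunks (2 ^ (m - 1)) (map (\<lambda>u. hd (tl u)) a))"
      using inv by (cases s) (auto simp: I_def m numeral_2_eq_2)
    have d: "\<forall>u \<in> set a. length u = 2" "\<forall>v \<in> set bs. length v = 2"
      using dims set by auto
    show "I (Suc j) (val (level_A (Array a) (Array bs) ?na ?nb k j s)) \<and>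
        time (level_A (Array a) (Array bs) ?na ?nb k j s) \<le> 30 * (?na + ?nb + 1) * (?c + 1) ^ 1"
      using level_A_val_time[OF d k_def es] by (simp add: I_def m s len)
  qed simp
  have "val (algorithm_A as bs) = map (count_upto a ?c) bs"
    using loop by (auto simp: algorithm_A_unfold sortA locv len I_def case_prod_beta)
  also note result
  finally have val: "val (algorithm_A as bs) = map (dominated as) bs" .
  have "time (algorithm_A as bs) =
      time (sort_first as) + (?nb + 1) + 2 + time (locate (Array a) (Array bs)) +
      time (ceil_log2 ?na) + time ?loop + (?nb + 1)"
    using loop by (simp add: algorithm_A_unfold sortA locv len I_def case_prod_beta)
  also have "\<dots> \<le> (2 + 40) * (?na + ?nb + 1) * (?c + 1) +
      (1 + ?c * (30 * (?na + ?nb + 1) * (?c + 1) ^ 1 + 2)) + (?nb + 1)"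
    using prelude loop by simp
  also have "\<dots> \<le> 76 * (?na + ?nb + 1) * (?c + 1) ^ 2"
    using total_cost_le[of "2 + 40" ?na ?nb ?c 30 1] by (simp add: numeral_2_eq_2)
  finally show "val (algorithm_A as bs) = map (dominated as) bs \<and>
      time (algorithm_A as bs) \<le> 76 * (?na + ?nb + 1) * (?c + 1) ^ 2"
    using val by blast
qed

section \<open>Algorithm B\<close>

definition block_vectors :: "vect array \<Rightarrow> nat \<Rightarrow> nat \<Rightarrow> nat \<Rightarrow> vect list timed" where
  "block_vectors a na w = (\<lambda>j'. do {
         hi \<leftarrow> Defs.mult w j';
         lo \<leftarrow> sub hi w;
         lo \<leftarrow> add lo 1;
         hi \<leftarrow> minimum hi na;
         tabulate lo hi (\<lambda>i. do { ai \<leftarrow> aget a i; tail ai })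
       })"

definition distribute_step ::
  "vect array \<Rightarrow> nat array \<Rightarrow> nat \<Rightarrow> nat \<Rightarrow> vect list array \<times> nat list array \<Rightarrow>
   (vect list array \<times> nat list array) timed" where
  "distribute_step b k w = (\<lambda>i (\<B>, \<C>). do {
         ki \<leftarrow> aget k i;
         block \<leftarrow> even_block w ki;
         case block of
           None \<Rightarrow> return (\<B>, \<C>)
         | Some l \<Rightarrow> do {
             l' \<leftarrow> sub l 1;
             bi \<leftarrow> aget b i;
             v \<leftarrow> tail bi;
             vs \<leftarrow> aget \<B> l';
             \<B> \<leftarrow> aset \<B> l' (v # vs);
             is \<leftarrow> aget \<C> l';
             \<C> \<leftarrow> aset \<C> l' (i # is);
             return (\<B>, \<C>)
           }
       })"

definition block_ranks_step ::
  "(vect list \<Rightarrow> vect list \<Rightarrow> nat list timed) \<Rightarrow> vect list array \<Rightarrow> vect list array \<Rightarrow>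
   nat list array \<Rightarrow> nat \<Rightarrow> nat array \<Rightarrow> nat array timed" where
  "block_ranks_step subroutine \<A> \<B> \<C> = (\<lambda>j' c. do {
         us \<leftarrow> aget \<A> j';
         vs \<leftarrow> aget \<B> j';
         is \<leftarrow> aget \<C> j';
         rs \<leftarrow> subroutine us vs;
         add_ranks is rs c
       })"

definition level_B ::
  "(vect list \<Rightarrow> vect list \<Rightarrow> nat list timed) \<Rightarrow> vect array \<Rightarrow> vect array \<Rightarrow> nat \<Rightarrow> nat \<Rightarrow>
   nat array \<Rightarrow> nat \<Rightarrow> nat \<times> nat array \<Rightarrow> (nat \<times> nat array) timed" where
  "level_B subroutine a b na nb k = (\<lambda>j (w, c). do {
       J \<leftarrow> ceil_quot na w;
       As \<leftarrow> tabulate 1 J (block_vectors a na w);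
       \<A> \<leftarrow> array_of As;
       \<B> \<leftarrow> new_array J [];
       \<C> \<leftarrow> new_array J [];
       (\<B>, \<C>) \<leftarrow> for_loop 1 nb (distribute_step b k w) (\<B>, \<C>);
       c \<leftarrow> for_loop 1 J (block_ranks_step subroutine \<A> \<B> \<C>) c;
       w \<leftarrow> add w w;
       return (w, c)
     })"

lemma algorithm_B_with_unfold:
  "algorithm_B_with subroutine as bs = do {
     a \<leftarrow> sort_first as;
     b \<leftarrow> array_of bs;
     na \<leftarrow> asize a;
     nb \<leftarrow> asize b;
     (k, c) \<leftarrow> locate a b;
     levels \<leftarrow> ceil_log2 na;
     (_, c) \<leftarrow> for_loop 1 levels (level_B subroutine a b na nb k) (1, c);
     list_of c
   }"
  unfolding algorithm_B_with_def level_B_def block_vectors_def distribute_step_def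
    block_ranks_step_def
  by (rule refl)

lemma block_vectors_val_time:
  assumes "0 < w" "q < length (chunks w a)"
  shows "val (block_vectors (Array a) (length a) w (Suc q)) = chunks w (map tl a) ! q"
    and "time (block_vectors (Array a) (length a) w (Suc q)) = 5 + 4 * length (chunks w a ! q)"
proof -
  define lo hi where "lo = Suc (w * q)" and "hi = min (w * Suc q) (length a)"
  have len: "Suc hi - lo = length (chunks w a ! q)"
    using assms by (auto simp: nth_chunks lo_def hi_def min_def)
  have "map (\<lambda>i. tl (a ! (i - 1))) [lo..<Suc hi] = map tl (chunks w a ! q)"
  proof (rule nth_equalityI)
    fix i assume "i < length (map (\<lambda>i. tl (a ! (i - 1))) [lo..<Suc hi])"
    then have i: "i < Suc hi - lo" by (simp del: upt_Suc)
    then have "[lo..<Suc hi] ! i = lo + i" by (intro nth_upt) simp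
    moreover have "i < w" "w * q + i < length a"
      using i assms by (auto simp: lo_def hi_def)
    ultimately show "map (\<lambda>i. tl (a ! (i - 1))) [lo..<Suc hi] ! i = map tl (chunks w a ! q) ! i"
      using i len assms(2) by (simp del: upt_Suc add: nth_chunks lo_def)
  qed (simp add: len del: upt_Suc)
  moreover have "map tl (chunks w a ! q) = chunks w (map tl a) ! q"
    using assms(2) by (simp flip: map_chunks)
  ultimately show "val (block_vectors (Array a) (length a) w (Suc q)) = chunks w (map tl a) ! q"
    by (simp add: block_vectors_def tabulate_val_time lo_def hi_def del: upt_Suc)
  have "time (block_vectors (Array a) (length a) w (Suc q)) = 5 + 4 * (Suc hi - lo)"
    by (simp add: block_vectors_def tabulate_val_time lo_def hi_def)
  then show "time (block_vectors (Array a) (length a) w (Suc q)) = 5 + 4 * length (chunks w a ! q)"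
    by (simp add: len)
qed

lemma sum_nth_eq_sum_list: "(\<Sum>q=1..length xs. f (xs ! (q - 1))) = (\<Sum>x\<leftarrow>xs. f x)"
proof -
  have "(\<Sum>q=1..length xs. f (xs ! (q - 1))) = (\<Sum>q<length xs. f (xs ! q))"
    by (rule sum.reindex_bij_witness[of _ Suc "\<lambda>q. q - 1"]) auto
  then show ?thesis by (simp add: sum_list_sum_nth atLeast0LessThan)
qed

lemma tabulate_blocks:
  assumes "0 < w"
  shows "val (tabulate 1 (length (chunks w a)) (block_vectors (Array a) (length a) w)) =
      chunks w (map tl a)"
    and "time (tabulate 1 (length (chunks w a)) (block_vectors (Array a) (length a) w)) \<le>
      1 + 11 * length a"
proof -
  let ?J = "length (chunks w a)"
  have "map (\<lambda>j'. val (block_vectors (Array a) (length a) w j')) [1..<Suc ?J] =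
      chunks w (map tl a)"
    by (rule nth_equalityI)
      (simp_all del: upt_Suc add: block_vectors_val_time(1)[OF assms, simplified] flip: map_chunks)
  then show "val (tabulate 1 ?J (block_vectors (Array a) (length a) w)) = chunks w (map tl a)"
    by (simp add: tabulate_val_time del: upt_Suc)
  have "time (tabulate 1 ?J (block_vectors (Array a) (length a) w)) =
      1 + (\<Sum>q=1..?J. 4 * length (chunks w a ! (q - 1)) + 7)"
  proof -
    have step: "time (block_vectors (Array a) (length a) w q) + 2 =
        4 * length (chunks w a ! (q - 1)) + 7" if "q \<in> {1..?J}" for q
      using that block_vectors_val_time(2)[OF assms, of "q - 1" a] by (cases q) auto
    show ?thesis unfolding tabulate_val_time by (simp only: sum.cong[OF refl step])
  qed
  also have "\<dots> = 1 + (4 * length a + 7 * ?J)"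
    using sum_nth_eq_sum_list[of length "chunks w a"] sum_length_chunks[OF assms, of a]
    by (simp add: sum.distrib flip: sum_distrib_left)
  also have "\<dots> \<le> 1 + 11 * length a"
    using length_chunks_le[of w a] by simp
  finally show "time (tabulate 1 ?J (block_vectors (Array a) (length a) w)) \<le> 1 + 11 * length a" .
qed

text \<open>The query indices in cell number \<open>Suc q\<close> of \<open>\<C>\<close> before iteration \<open>t\<close>, the most recent one first.
  Cell \<open>Suc q\<close> receives the queries with quotient \<open>(k - 1) div w = Suc q\<close>, provided that this is
  odd.\<close>

definition assigned :: "nat \<Rightarrow> vect list \<Rightarrow> vect list \<Rightarrow> nat \<Rightarrow> nat \<Rightarrow> nat list" where
  "assigned w a bs t q =
     rev (filter (\<lambda>i. (first_rank a (bs ! (i - 1)) - 1) div w = Suc q \<and> even q) [1..<t])"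

text \<open>The classes \<open>f x = h q\<close> are disjoint for different \<open>q\<close>, so no element is counted twice.  The
  queries assigned to the blocks of a level are such classes.\<close>

lemma sum_length_filter_le:
  assumes "finite Q" "inj_on h Q"
  shows "(\<Sum>q\<in>Q. length (filter (\<lambda>x. f x = h q \<and> P q) xs)) \<le> length xs"
proof (induction xs)
  case (Cons x xs)
  have "(\<Sum>q\<in>Q. if f x = h q \<and> P q then 1 else 0) = card {q \<in> Q. f x = h q \<and> P q}"
    using assms(1) by (simp add: sum.If_cases Int_def)
  also have "\<dots> \<le> 1"
    using assms by (auto simp: card_le_Suc0_iff_eq dest: inj_onD)
  finally have "(\<Sum>q\<in>Q. if f x = h q \<and> P q then 1 else 0) \<le> (1::nat)" .
  moreover have "(\<Sum>q\<in>Q. length (filter (\<lambda>x. f x = h q \<and> P q) (x # xs))) =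
      (\<Sum>q\<in>Q. if f x = h q \<and> P q then 1 else 0) +
      (\<Sum>q\<in>Q. length (filter (\<lambda>x. f x = h q \<and> P q) xs))"
    unfolding sum.distrib[symmetric] by (rule sum.cong) auto
  ultimately show ?case using Cons.IH by simp
qed simp

lemma assigned_properties:
  "distinct (assigned w a bs t q)"
  "i \<in> set (assigned w a bs t q) \<longleftrightarrow>
     1 \<le> i \<and> i < t \<and> (first_rank a (bs ! (i - 1)) - 1) div w = Suc q \<and> even q"
  "(\<Sum>q<J. length (assigned w a bs (Suc n) q)) \<le> n"
proof -
  show "(\<Sum>q<J. length (assigned w a bs (Suc n) q)) \<le> n"
    using sum_length_filter_le[of "{..<J}" Suc
        "\<lambda>i. (first_rank a (bs ! (i - 1)) - 1) div w" even "[1..<Suc n]"]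
    by (simp add: assigned_def del: upt_Suc)
qed (auto simp: assigned_def)

text \<open>After the distribution the cells of \<open>\<B>\<close> and \<open>\<C>\<close> list the same queries in the same order, so
  that the ranks returned for a cell of \<open>\<B>\<close> belong to the indices in the cell of \<open>\<C>\<close>.\<close>

lemma distribute_val_time:
  fixes a bs :: "vect list" and w :: nat
  defines "J \<equiv> length (chunks w a)"
  assumes w: "0 < w" and k: "k = Array (map (first_rank a) bs)"
  shows "val (for_loop 1 (length bs) (distribute_step (Array bs) k w)
        (Array (replicate J []), Array (replicate J []))) =
      (Array (map (\<lambda>q. map (\<lambda>i. tl (bs ! (i - 1))) (assigned w a bs (Suc (length bs)) q)) [0..<J]),
       Array (map (assigned w a bs (Suc (length bs))) [0..<J]))"
    and "time (for_loop 1 (length bs) (distribute_step (Array bs) k w)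
        (Array (replicate J []), Array (replicate J []))) \<le> 1 + 16 * length bs"
proof -
  let ?tails = "map (\<lambda>i. tl (bs ! (i - 1)))"
  define I where "I t s \<longleftrightarrow>
      s = (Array (map (\<lambda>q. ?tails (assigned w a bs t q)) [0..<J]),
           Array (map (assigned w a bs t) [0..<J]))" for t s
  have "I (Suc (length bs)) (val (for_loop 1 (length bs) (distribute_step (Array bs) k w)
        (Array (replicate J []), Array (replicate J [])))) \<and>
      time (for_loop 1 (length bs) (distribute_step (Array bs) k w)
        (Array (replicate J []), Array (replicate J []))) \<le> 1 + (\<Sum>i=1..length bs. 14 + 2)"
  proof (rule for_loop_invariant)
    show "I 1 (Array (replicate J []), Array (replicate J []))"
      by (auto simp: I_def assigned_def intro!: nth_equalityI)
    fix i s assume i: "1 \<le> i" "i \<le> length bs" and inv: "I i s"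
    let ?r = "first_rank a (bs ! (i - 1))"
    define l where "l = (?r - 1) div w"
    have ki: "elems k ! (i - 1) = ?r" using i by (simp add: k)
    have block: "val (even_block w ?r) = (if odd l then Some (l + 1) else None)"
      by (simp add: even_block_val_time(1) l_def)
    have grow: "assigned w a bs (Suc i) q =
        (if l = Suc q \<and> even q then i # assigned w a bs i q else assigned w a bs i q)" for q
      using i by (simp add: assigned_def l_def)
    show "I (Suc i) (val (distribute_step (Array bs) k w i s)) \<and>
        time (distribute_step (Array bs) k w i s) \<le> 14"
    proof (cases "odd l")
      case False
      then have "assigned w a bs (Suc i) q = assigned w a bs i q" for q by (auto simp: grow)
      then show ?thesis
        using False inv block ki even_block_val_time(2)[of w ?r]
        by (simp add: distribute_step_def I_def)
    next
      case True
      then obtain p where l: "l = Suc p" by (cases l) auto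
      have p: "p < J"
        using level_count_chunk(1)[OF w, of a "bs ! (i - 1)"] True
        unfolding l_def[symmetric] l J_def by simp
      have "val (distribute_step (Array bs) k w i s) =
          (Array ((map (\<lambda>q. ?tails (assigned w a bs i q)) [0..<J])
              [p := tl (bs ! (i - 1)) # ?tails (assigned w a bs i p)]),
           Array ((map (assigned w a bs i) [0..<J])[p := i # assigned w a bs i p]))"
        using True inv block ki p by (simp add: distribute_step_def I_def l)
      moreover have "\<dots> = (Array (map (\<lambda>q. ?tails (assigned w a bs (Suc i) q)) [0..<J]),
           Array (map (assigned w a bs (Suc i)) [0..<J]))"
        using True p by (auto intro!: nth_equalityI simp: grow l nth_list_update)
      moreover have "time (distribute_step (Array bs) k w i s) \<le> 14"
        using True inv block ki even_block_val_time(2)[of w ?r]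
        by (simp add: distribute_step_def I_def)
      ultimately show ?thesis by (simp add: I_def)
    qed
  qed simp
  then show "val (for_loop 1 (length bs) (distribute_step (Array bs) k w)
        (Array (replicate J []), Array (replicate J []))) =
      (Array (map (\<lambda>q. ?tails (assigned w a bs (Suc (length bs)) q)) [0..<J]),
       Array (map (assigned w a bs (Suc (length bs))) [0..<J]))"
    and "time (for_loop 1 (length bs) (distribute_step (Array bs) k w)
        (Array (replicate J []), Array (replicate J []))) \<le> 1 + 16 * length bs"
    by (simp_all add: I_def)
qed

text \<open>Distinctness matters: each counter mentioned is then increased by its own rank exactly once.\<close>

lemma add_ranks_val:
  assumes "distinct is" "\<And>i. i \<in> set is \<Longrightarrow> 1 \<le> i \<and> i \<le> length (elems c)"
  shows "length (elems (val (add_ranks is (map f is) c))) = length (elems c) \<and>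
    (\<forall>x < length (elems c). elems (val (add_ranks is (map f is) c)) ! x =
       elems c ! x + (if Suc x \<in> set is then f (Suc x) else 0))"
  using assms
proof (induction "is" arbitrary: c)
  case (Cons i "is")
  define c' where "c' = Array ((elems c)[i - 1 := elems c ! (i - 1) + f i])"
  have "length (elems (val (add_ranks is (map f is) c'))) = length (elems c') \<and>
    (\<forall>x < length (elems c'). elems (val (add_ranks is (map f is) c')) ! x =
       elems c' ! x + (if Suc x \<in> set is then f (Suc x) else 0))"
    by (rule Cons.IH) (use Cons.prems in \<open>auto simp: c'_def\<close>)
  moreover have "val (add_ranks (i # is) (map f (i # is)) c) = val (add_ranks is (map f is) c')"
    by (simp add: c'_def)
  moreover have "1 \<le> i" using Cons.prems by simp
  ultimately show ?case using Cons.prems(1)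
    by (auto simp: c'_def nth_list_update)
qed simp

lemma time_add_ranks: "time (add_ranks is rs c) \<le> 4 * length is + 1"
  by (induction "is" rs c rule: add_ranks.induct) auto

text \<open>A query is increased in the iteration of its own block, where the subroutine counts in
  that block.  For the cost, the blocks partition \<open>a\<close>, each query occurs in at most one of them, and
  there are at most \<open>n\<^sub>a\<close> blocks, so the sizes plus one sum up to at most
  \<open>2 (n\<^sub>a + n\<^sub>b + 1)\<close>; this is the factor \<open>2\<close> before \<open>K\<close>.\<close>

lemma block_ranks_val_time:
  fixes a bs :: "vect list" and w d K :: nat
  defines "J \<equiv> length (chunks w a)"
    and "is \<equiv> assigned w a bs (Suc (length bs))"
  defines "\<A> \<equiv> Array (chunks w (map tl a))"
    and "\<B> \<equiv> Array (map (\<lambda>q. map (\<lambda>i. tl (bs ! (i - 1))) (is q)) [0..<J])"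
    and "\<C> \<equiv> Array (map is [0..<J])"
  assumes w: "0 < w" and sub: "ranks_within d K alg"
    and dims: "\<forall>u \<in> set a. length u = Suc d" "\<forall>v \<in> set bs. length v = Suc d"
  shows "val (for_loop 1 J (block_ranks_step alg \<A> \<B> \<C>) (Array (map g bs))) =
      Array (map (\<lambda>v. g v + level_count a v w) bs)"
    and "time (for_loop 1 J (block_ranks_step alg \<A> \<B> \<C>) (Array (map g bs))) \<le>
      1 + 2 * K * (length a + length bs + 1) * (clog (length a) + 1) ^ d +
      4 * length bs + 6 * length a"
proof -
  let ?L = "clog (length a) + 1"
  let ?q = "\<lambda>x. (first_rank a (bs ! x) - 1) div w"
  define us where "us q = chunks w (map tl a) ! q" for q
  \<comment> \<open>before iteration \<open>t\<close> exactly the queries whose block number \<open>?q x\<close> is below \<open>t\<close> are served\<close>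
  define I where "I t c \<longleftrightarrow> length (elems c) = length bs \<and>
    (\<forall>x < length bs. elems c ! x = g (bs ! x) +
       (if odd (?q x) \<and> ?q x < t then level_count a (bs ! x) w else 0))" for t c
  define C where "C j' = K * (length (us (j' - 1)) + length (is (j' - 1)) + 1) * ?L ^ d +
      4 * length (is (j' - 1)) + 4" for j'
  have J: "length (chunks w (map tl a)) = J" by (simp add: J_def flip: map_chunks)
  have loop: "I (Suc J) (val (for_loop 1 J (block_ranks_step alg \<A> \<B> \<C>) (Array (map g bs)))) \<and>
    time (for_loop 1 J (block_ranks_step alg \<A> \<B> \<C>) (Array (map g bs))) \<le>
      1 + (\<Sum>j'=1..J. C j' + 2)"
  proof (rule for_loop_invariant)
    show "I 1 (Array (map g bs))" by (auto simp: I_def)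
    fix j' c assume j': "1 \<le> j'" "j' \<le> J" and inv: "I j' c"
    obtain q where q: "j' = Suc q" using j' by (cases j') auto
    let ?vs = "map (\<lambda>i. tl (bs ! (i - 1))) (is q)"
    let ?f = "\<lambda>i. dominated (us q) (tl (bs ! (i - 1)))"
    have qJ: "q < J" using j' q by simp
    have mem: "us q \<in> set (chunks w (map tl a))"
      using qJ J by (simp add: us_def)
    have short: "length (us q) \<le> length a"
      using qJ J by (simp add: us_def nth_chunks)
    have sub_dims: "\<forall>v \<in> set (us q) \<union> set ?vs. length v = d"
    proof -
      have "\<forall>v \<in> set (us q). length v = d"
        using set_chunks[OF mem] dims(1) by auto
      moreover have "\<forall>v \<in> set ?vs. length v = d"
        using dims(2) by (auto simp: is_def assigned_properties(2))
      ultimately show ?thesis by blast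
    qed
    have sub_val: "val (alg (us q) ?vs) = map ?f (is q)"
      and sub_time: "time (alg (us q) ?vs) \<le>
        K * (length (us q) + length (is q) + 1) * (clog (length (us q)) + 1) ^ d"
      using ranks_withinD[OF sub sub_dims] by (simp_all add: o_def)
    have "(clog (length (us q)) + 1) ^ d \<le> ?L ^ d"
      using clog_mono[OF short] by (intro power_mono) auto
    then have "K * (length (us q) + length (is q) + 1) * (clog (length (us q)) + 1) ^ d \<le>
        K * (length (us q) + length (is q) + 1) * ?L ^ d"
      by (rule mult_le_mono2)
    with sub_time have sub_time':
      "time (alg (us q) ?vs) \<le> K * (length (us q) + length (is q) + 1) * ?L ^ d"
      by (rule order_trans)
    have fetch: "elems \<A> ! q = us q" "elems \<B> ! q = ?vs" "elems \<C> ! q = is q"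
      using qJ by (simp_all add: \<A>_def \<B>_def \<C>_def us_def)
    have "block_ranks_step alg \<A> \<B> \<C> j' c = Timed
        (val (add_ranks (is q) (val (alg (us q) ?vs)) c))
        (3 + time (alg (us q) ?vs) + time (add_ranks (is q) (val (alg (us q) ?vs)) c))"
      unfolding block_ranks_step_def q by (simp add: bind_timed_def fetch[simplified])
    then have run: "block_ranks_step alg \<A> \<B> \<C> j' c = Timed
        (val (add_ranks (is q) (map ?f (is q)) c))
        (3 + time (alg (us q) ?vs) + time (add_ranks (is q) (map ?f (is q)) c))"
      by (simp only: sub_val)
    have "time (block_ranks_step alg \<A> \<B> \<C> j' c) \<le> C j'"
      using sub_time' time_add_ranks[of "is q" "map ?f (is q)" c]
      unfolding run unfolding C_def timed.sel q diff_Suc_1 by linarith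
    moreover have "val (block_ranks_step alg \<A> \<B> \<C> j' c) =
        val (add_ranks (is q) (map ?f (is q)) c)"
      by (simp only: run timed.sel)
    moreover have "I (Suc j') (val (add_ranks (is q) (map ?f (is q)) c))"
    proof -
      have len: "length (elems c) = length bs" using inv by (simp add: I_def)
      have added: "length (elems (val (add_ranks (is q) (map ?f (is q)) c))) = length (elems c) \<and>
        (\<forall>x < length (elems c). elems (val (add_ranks (is q) (map ?f (is q)) c)) ! x =
           elems c ! x + (if Suc x \<in> set (is q) then ?f (Suc x) else 0))"
        by (rule add_ranks_val) (auto simp: is_def assigned_properties len)
      have new: "(if Suc x \<in> set (is q) then ?f (Suc x) else 0) =
          (if odd (?q x) \<and> ?q x = j' then level_count a (bs ! x) w else 0)"
        if "x < length bs" for x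
      proof -
        have "Suc x \<in> set (is q) \<longleftrightarrow> odd (?q x) \<and> ?q x = j'"
          using that by (auto simp: is_def assigned_properties(2) q)
        moreover have "level_count a (bs ! x) w = ?f (Suc x)" if "odd (?q x)" "?q x = j'"
          using level_count_chunk(2)[OF w that(1)] that(2) by (simp add: us_def q)
        ultimately show ?thesis by auto
      qed
      show ?thesis
        using added new inv by (auto simp: I_def len less_Suc_eq)
    qed
    ultimately show "I (Suc j') (val (block_ranks_step alg \<A> \<B> \<C> j' c)) \<and>
        time (block_ranks_step alg \<A> \<B> \<C> j' c) \<le> C j'"
      by simp
  qed simp
  have "(if odd (?q x) \<and> ?q x < Suc J then level_count a (bs ! x) w else 0) =
      level_count a (bs ! x) w" for x
    using level_count_chunk(1)[OF w, of a "bs ! x"] level_count_eq_0[of a "bs ! x" w]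
    unfolding J_def by (cases "odd (?q x)") (simp_all, linarith)
  then show "val (for_loop 1 J (block_ranks_step alg \<A> \<B> \<C>) (Array (map g bs))) =
      Array (map (\<lambda>v. g v + level_count a v w) bs)"
    using loop
    by (auto simp: I_def intro!: array.expand nth_equalityI)
  have sum_us: "(\<Sum>j'=1..J. length (us (j' - 1))) = length a"
    using sum_nth_eq_sum_list[of length "chunks w (map tl a)"] sum_length_chunks[OF w, of "map tl a"]
    by (simp add: J us_def)
  have sum_is: "(\<Sum>j'=1..J. length (is (j' - 1))) \<le> length bs"
  proof -
    have "(\<Sum>j'=1..J. length (is (j' - 1))) = (\<Sum>q<J. length (is q))"
      by (rule sum.reindex_bij_witness[of _ Suc "\<lambda>q. q - 1"]) auto
    then show ?thesis using assigned_properties(3) by (simp add: is_def)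
  qed
  have J_le: "J \<le> length a" unfolding J_def by (rule length_chunks_le)
  let ?S = "\<Sum>j'=1..J. length (us (j' - 1)) + length (is (j' - 1)) + 1"
  have "(\<Sum>j'=1..J. C j' + 2) =
      K * ?S * ?L ^ d + 4 * (\<Sum>j'=1..J. length (is (j' - 1))) + 6 * J"
    unfolding C_def by (simp add: sum.distrib sum_distrib_left sum_distrib_right algebra_simps)
  moreover have "?S \<le> 2 * (length a + length bs + 1)"
    using sum_us sum_is J_le unfolding sum.distrib by simp
  then have "K * ?S * ?L ^ d \<le> K * (2 * (length a + length bs + 1)) * ?L ^ d"
    by (intro mult_le_mono) auto
  then have "K * ?S * ?L ^ d \<le> 2 * K * (length a + length bs + 1) * ?L ^ d"
    by (simp only: mult.assoc mult.left_commute[of K 2])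
  ultimately show "time (for_loop 1 J (block_ranks_step alg \<A> \<B> \<C>) (Array (map g bs))) \<le>
      1 + 2 * K * (length a + length bs + 1) * ?L ^ d + 4 * length bs + 6 * length a"
    using loop sum_is J_le by linarith
qed

lemma level_B_val_time:
  assumes k: "k = Array (map (first_rank a) bs)" and sub: "ranks_within d K alg"
    and dims: "\<forall>u \<in> set a. length u = Suc d" "\<forall>v \<in> set bs. length v = Suc d"
  shows "val (level_B alg (Array a) (Array bs) (length a) (length bs) k (Suc m)
        (2 ^ m, Array (map (count_upto a m) bs))) =
      (2 ^ Suc m, Array (map (count_upto a (Suc m)) bs))"
    and "time (level_B alg (Array a) (Array bs) (length a) (length bs) k (Suc m)
        (2 ^ m, Array (map (count_upto a m) bs))) \<le>
      (2 * K + 20) * (length a + length bs + 1) * (clog (length a) + 1) ^ d"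
proof -
  let ?w = "2 ^ m :: nat" and ?M = "(length a + length bs + 1) * (clog (length a) + 1) ^ d"
  let ?J = "length (chunks ?w a)"
  have w: "0 < ?w" by simp
  note blocks = tabulate_blocks[OF w, of a] and distribute = distribute_val_time[OF w k]
    and ranks = block_ranks_val_time[OF w sub dims, of "count_upto a m"]
  \<comment> \<open>The number of blocks is read as a length below, hence the rule for \<open>ceil_quot\<close> is disabled there.\<close>
  have J: "val (ceil_quot (length a) ?w) = ?J" by (simp add: length_chunks)
  have J': "length (chunks ?w (map tl a)) = ?J" by (simp flip: map_chunks)
  let ?run = "level_B alg (Array a) (Array bs) (length a) (length bs) k (Suc m)
        (?w, Array (map (count_upto a m) bs))"
  show "val ?run = (2 ^ Suc m, Array (map (count_upto a (Suc m)) bs))"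
    unfolding level_B_def
    by (simp add: J blocks(1) distribute(1) ranks(1) del: ceil_quot_val_time One_nat_def)
  have "1 \<le> (clog (length a) + 1) ^ d" by simp
  then have M: "length a + length bs + 1 \<le> ?M"
    using mult_le_mono2[of 1 _ "length a + length bs + 1"] by simp
  have "time ?run \<le> 2 * K * ?M + 20 * (length a + length bs + 1)"
    unfolding level_B_def
    using blocks(2) distribute(2) ranks(2) length_chunks_le[of ?w a]
    by (simp add: J J' blocks(1) distribute(1) ranks(1) mult.assoc
        del: ceil_quot_val_time(1) One_nat_def)
  also have "\<dots> \<le> 2 * K * ?M + 20 * ?M"
    using M by (intro add_left_mono mult_le_mono2)
  finally show "time ?run \<le> (2 * K + 20) * (length a + length bs + 1) * (clog (length a) + 1) ^ d"
    by (simp only: add_mult_distrib mult.assoc)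
qed

text \<open>One more dimension costs one more factor \<open>L\<close>, which bounds the number of levels.\<close>

lemma algorithm_B_with_ranks_within:
  assumes sub: "ranks_within d K alg"
  shows "ranks_within (Suc d) (Suc d + 2 * K + 64) (algorithm_B_with alg)"
  unfolding ranks_within_def
proof (intro allI impI)
  fix as bs :: "vect list"
  assume dims: "\<forall>v \<in> set as \<union> set bs. length v = Suc d"
  let ?na = "length as" and ?nb = "length bs" and ?c = "clog (length as)"
  obtain a where sortA: "val (sort_first as) = Array a"
    and len: "length a = ?na" and set: "set a = set as"
    and locv: "val (locate (Array a) (Array bs)) =
      (Array (map (first_rank a) bs), Array (map (count_upto a 0) bs))"
    and prelude: "time (sort_first as) + (?nb + 1) + 2 + time (locate (Array a) (Array bs)) +
      time (ceil_log2 ?na) \<le> (Suc d + 40) * (?na + ?nb + 1) * (?c + 1)"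
    and result: "map (count_upto a ?c) bs = map (dominated as) bs"
    by (rule sort_and_locate[of as bs d]) (use dims in auto)
  define k where "k = Array (map (first_rank a) bs)"
  note locv = locv[folded k_def]
  let ?loop = "for_loop 1 ?c (level_B alg (Array a) (Array bs) ?na ?nb k)
     (1, Array (map (count_upto a 0) bs))"
  define I where "I t s \<longleftrightarrow> s = (2 ^ (t - 1), Array (map (count_upto a (t - 1)) bs))"
    for t and s :: "nat \<times> nat array"
  have loop: "I (Suc ?c) (val ?loop) \<and>
     time ?loop \<le> 1 + (\<Sum>j=1..?c. (2 * K + 20) * (?na + ?nb + 1) * (?c + 1) ^ d + 2)"
  proof (rule for_loop_invariant)
    show "I 1 (1, Array (map (count_upto a 0) bs))" by (simp add: I_def)
    fix j s assume j: "1 \<le> j" and inv: "I j s"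
    obtain m where m: "j = Suc m" using j by (cases j) auto
    have d: "\<forall>u \<in> set a. length u = Suc d" "\<forall>v \<in> set bs. length v = Suc d"
      using dims set by auto
    show "I (Suc j) (val (level_B alg (Array a) (Array bs) ?na ?nb k j s)) \<and>
        time (level_B alg (Array a) (Array bs) ?na ?nb k j s) \<le>
          (2 * K + 20) * (?na + ?nb + 1) * (?c + 1) ^ d"
      using level_B_val_time[OF k_def sub d, of m] inv by (simp add: I_def m len)
  qed simp
  have "val (algorithm_B_with alg as bs) = map (count_upto a ?c) bs"
    using loop by (auto simp: algorithm_B_with_unfold sortA locv len I_def case_prod_beta)
  also note result
  finally have val: "val (algorithm_B_with alg as bs) = map (dominated as) bs" .
  have "time (algorithm_B_with alg as bs) =
      time (sort_first as) + (?nb + 1) + 2 + time (locate (Array a) (Array bs)) +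
      time (ceil_log2 ?na) + time ?loop + (?nb + 1)"
    using loop by (simp add: algorithm_B_with_unfold sortA locv len I_def case_prod_beta)
  also have "\<dots> \<le> (Suc d + 40) * (?na + ?nb + 1) * (?c + 1) +
      (1 + ?c * ((2 * K + 20) * (?na + ?nb + 1) * (?c + 1) ^ d + 2)) + (?nb + 1)"
    using prelude loop by simp
  also have "\<dots> \<le> (Suc d + 40 + (2 * K + 20) + 4) * (?na + ?nb + 1) * (?c + 1) ^ Suc d"
    by (rule total_cost_le)
  finally show "val (algorithm_B_with alg as bs) = map (dominated as) bs \<and>
      time (algorithm_B_with alg as bs) \<le>
        (Suc d + 2 * K + 64) * (?na + ?nb + 1) * (?c + 1) ^ Suc d"
    using val by (simp add: algebra_simps)
qed

lemma algorithm_B_ranks_within: "3 \<le> d \<Longrightarrow> \<exists>K. ranks_within d K (algorithm_B d)"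
proof (induction d rule: nat_induct_at_least)
  case base
  have "algorithm_B 3 = algorithm_B_with algorithm_A" by (simp add: algorithm_B.simps[of 3])
  then show ?case
    using algorithm_B_with_ranks_within[OF algorithm_A_ranks_within] by auto
next
  case (Suc d)
  then have "algorithm_B (Suc d) = algorithm_B_with (algorithm_B d)"
    by (simp add: algorithm_B.simps[of "Suc d"])
  then show ?case using Suc.IH algorithm_B_with_ranks_within by metis
qed

section \<open>Asymptotics\<close>

lemma clog_le_ln:
  assumes "2 \<le> n"
  shows "real (clog n + 1) \<le> 3 / ln 2 * ln (real n)"
proof -
  have "1 \<le> log 2 (real n)" using assms by simp
  then have "real (clog n) \<le> log 2 (real n) + 1"
    unfolding val_ceil_log2 by linarith
  then have "real (clog n + 1) \<le> 3 * log 2 (real n)"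
    using \<open>1 \<le> log 2 (real n)\<close> by simp
  then show ?thesis by (simp add: log_def)
qed

text \<open>For \<open>n \<ge> 2\<close> both \<open>2 n + 1 \<le> 3 n\<close> and \<open>L \<le> 3 log\<^sub>2 n\<close>, which turns the explicit bound at
  \<open>n = max n\<^sub>a n\<^sub>b\<close> into the asymptotic one.\<close>

lemma ranks_within_bigo:
  assumes "ranks_within d K alg"
  shows "\<exists>T \<in> O(\<lambda>n::nat. real n * ln (real n) ^ d).
    \<forall>as bs. (\<forall>v \<in> set as \<union> set bs. length v = d) \<longrightarrow>
      real (time (alg as bs)) \<le> T (max (length as) (length bs))"
proof (intro bexI allI impI)
  define T :: "nat \<Rightarrow> real" where "T n = real (K * (2 * n + 1) * (clog n + 1) ^ d)" for n
  fix as bs :: "vect list"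
  assume dims: "\<forall>v \<in> set as \<union> set bs. length v = d"
  let ?n = "max (length as) (length bs)"
  have "time (alg as bs) \<le> K * (length as + length bs + 1) * (clog (length as) + 1) ^ d"
    using assms dims by (simp add: ranks_within_def)
  also have "\<dots> \<le> K * (2 * ?n + 1) * (clog ?n + 1) ^ d"
    using clog_mono[of "length as" ?n] by (intro mult_le_mono power_mono) auto
  finally show "real (time (alg as bs)) \<le> T ?n" unfolding T_def of_nat_le_iff .
next
  show "(\<lambda>n. real (K * (2 * n + 1) * (clog n + 1) ^ d)) \<in> O(\<lambda>n. real n * ln (real n) ^ d)"
  proof (rule bigoI)
    show "\<forall>\<^sub>F n in sequentially. norm (real (K * (2 * n + 1) * (clog n + 1) ^ d)) \<le>
        (3 * real K * (3 / ln 2) ^ d) * norm (real n * ln (real n) ^ d)"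
      using eventually_ge_at_top[of 2]
    proof eventually_elim
      case (elim n)
      have "real (clog n + 1) ^ d \<le> (3 / ln 2 * ln (real n)) ^ d"
        using clog_le_ln[OF elim] by (intro power_mono) auto
      then have "real K * real (2 * n + 1) * real (clog n + 1) ^ d \<le>
          real K * (3 * real n) * (3 / ln 2 * ln (real n)) ^ d"
        using elim by (intro mult_mono) auto
      then show ?case using elim by (simp add: power_mult_distrib power_divide algebra_simps)
    qed
  qed
qed

lemma ranks_within_correct:
  assumes "ranks_within d K alg" "\<forall>v \<in> set as \<union> set bs. length v = d"
  shows "length (val (alg as bs)) = length bs \<and>
    (\<forall>i < length bs. val (alg as bs) ! i =
       (\<Sum>i' < length as. of_bool (list_all2 (\<le>) (as ! i') (bs ! i))))"
proof -
  have "dominated as v = (\<Sum>i' < length as. of_bool (list_all2 (\<le>) (as ! i') v))" for v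
    by (simp add: dominated_def length_filter_conv_card Int_def lessThan_def)
  then show ?thesis using assms by (simp add: ranks_within_def)
qed

theorem theorem8:
  "(\<exists>T \<in> O(\<lambda>n::nat. real n * ln (real n) ^ 2).
        \<forall>as bs. (\<forall>v \<in> set as \<union> set bs. length v = 2) \<longrightarrow>
          real (time (algorithm_A as bs)) \<le> T (max (length as) (length bs))) \<and>
   (\<forall>d\<ge>3. (\<exists>T \<in> O(\<lambda>n::nat. real n * ln (real n) ^ d).
        \<forall>as bs. (\<forall>v \<in> set as \<union> set bs. length v = d) \<longrightarrow>
          real (time (algorithm_B d as bs)) \<le> T (max (length as) (length bs)))) \<and>
   (\<forall>as bs. (\<forall>v \<in> set as \<union> set bs. length v = 2) \<longrightarrow>
        length (val (algorithm_A as bs)) = length bs \<and>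
        (\<forall>i < length bs. val (algorithm_A as bs) ! i =
           (\<Sum>i' < length as. of_bool (list_all2 (\<le>) (as ! i') (bs ! i))))) \<and>
   (\<forall>d\<ge>3. (\<forall>as bs. (\<forall>v \<in> set as \<union> set bs. length v = d) \<longrightarrow>
        length (val (algorithm_B d as bs)) = length bs \<and>
        (\<forall>i < length bs. val (algorithm_B d as bs) ! i =
           (\<Sum>i' < length as. of_bool (list_all2 (\<le>) (as ! i') (bs ! i))))))"
proof (intro conjI, goal_cases)
  case 1
  show ?case by (rule ranks_within_bigo[OF algorithm_A_ranks_within])
next
  case 2
  show ?case
    by (intro allI impI) (erule exE[OF algorithm_B_ranks_within], erule ranks_within_bigo)
next
  case 3
  show ?case by (intro allI impI) (rule ranks_within_correct[OF algorithm_A_ranks_within])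
next
  case 4
  show ?case
    by (intro allI impI) (erule exE[OF algorithm_B_ranks_within], erule (1) ranks_within_correct)
qed

end
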